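(* Let $\mathcal{H}$ be a separable complex Hilbert space and let $(F,G)=(\{f_k\}_{k=1}^\infty,\{g_k\}_{k=1}^\infty)$ be a biframe for $\mathcal{H}$ with biframe operator $S_{F,G}$. Let $U,V\in B(\mathcal{H})$, and let $p,q,r,t\in\mathbb{R}$ satisfy $p+q=1$ and $r+t=1$. Then: (i) $(\{Uf_k\}_{k=1}^\infty,\{Vg_k\}_{k=1}^\infty)$ is a biframe for $\mathcal{H}$ if and only if there exist $Q\in B^{+}_{b.b.}(\mathcal{H})$ and $T,W\in B(\mathcal{H})$ such that $TW^*=I$, $U=Q^{r}WS_{F,G}^{-p}$ and $V=Q^{t}TS_{F,G}^{-q}$. (ii) $(\{Uf_k\}_{k=1}^\infty,\{Vg_k\}_{k=1}^\infty)$ is a Parseval biframe for $\mathcal{H}$ if and only if there exist $T,W\in B(\mathcal{H})$ such that $TW^*=I$, $U=WS_{F,G}^{-p}$ and $V=TS_{F,G}^{-q}$. In particular, if $(\{f_k\}_{k=1}^\infty,\{g_k\}_{k=1}^\infty)$ is a Parseval biframe, then $(\{Uf_k\}_{k=1}^\infty,\{Vg_k\}_{k=1}^\infty)$ is a Parseval biframe if and only if $VU^*=I$.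
   Context: A pair $(F,G)=(\{f_k\}_{k=1}^\infty,\{g_k\}_{k=1}^\infty)$ of sequences in $\mathcal{H}$ is a biframe for $\mathcal{H}$ with bounds $A,B>0$ if $A\|f\|^2\le\sum_{k=1}^\infty\langle f,f_k\rangle\langle g_k,f\rangle\le B\|f\|^2$ for all $f\in\mathcal{H}$ (the series converging to a real number); it is Parseval if one can take $A=B=1$. The biframe operator is $S_{F,G}f=\sum_{k=1}^\infty\langle f,f_k\rangle g_k$ (the weak limit of the partial sums); for a biframe in a complex Hilbert space it is a bounded, positive, self-adjoint, invertible operator, so its real powers are defined by functional calculus. $B(\mathcal{H})$ is the set of bounded linear operators on $\mathcal{H}$, $I$ is the identity, and $B^{+}_{b.b.}(\mathcal{H})$ is the set of bounded, self-adjoint, positive operators on $\mathcal{H}$ that are bounded below ($\exists\alpha>0$: $\alpha\|f\|\le\|Tf\|$ for all $f$). The inner product is linear in the first variable. *)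

theory Defs
  imports "HOL-Analysis.Analysis"
begin

section \<open>Complex Hilbert spaces\<close>

class scaleC = scaleR +
  fixes scaleC :: "complex \<Rightarrow> 'a \<Rightarrow> 'a"  (infixr \<open>*\<^sub>C\<close> 75)

class complex_vector = real_vector + scaleC +
  assumes scaleC_add_right: "a *\<^sub>C (x + y) = a *\<^sub>C x + a *\<^sub>C y"
    and scaleC_add_left: "(a + b) *\<^sub>C x = a *\<^sub>C x + b *\<^sub>C x"
    and scaleC_scaleC: "a *\<^sub>C b *\<^sub>C x = (a * b) *\<^sub>C x"
    and scaleR_scaleC: "r *\<^sub>R x = complex_of_real r *\<^sub>C x"

text \<open>The inner product is linear in the first argument. The last axiom is
  \<open>\<langle>x, x\<rangle> = \<parallel>x\<parallel>\<^sup>2\<close>; since \<open>norm\<close> is a norm, it contains positive definiteness.\<close>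

class complex_inner = complex_vector + real_normed_vector +
  fixes cinner :: "'a \<Rightarrow> 'a \<Rightarrow> complex"
  assumes cinner_add_left: "cinner (x + y) z = cinner x z + cinner y z"
    and cinner_scaleC_left: "cinner (a *\<^sub>C x) y = a * cinner x y"
    and cinner_commute: "cinner x y = cnj (cinner y x)"
    and cinner_self: "cinner x x = complex_of_real ((norm x)\<^sup>2)"

class chilbert_space = complex_inner + banach


section \<open>Bounded operators\<close>

text \<open>Elements of \<open>B(H)\<close> are functions \<open>'a \<Rightarrow> 'a\<close> satisfying the following predicate; their
  product is \<open>(\<circ>)\<close>, the identity is \<open>id\<close> and the operator norm is \<open>onorm\<close>.\<close>

definition bounded_clinear :: "('a::complex_inner \<Rightarrow> 'a) \<Rightarrow> bool" where
  "bounded_clinear T \<longleftrightarrow> bounded_linear T \<and> (\<forall>c x. T (c *\<^sub>C x) = c *\<^sub>C T x)"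

definition cadjoint :: "('a::complex_inner \<Rightarrow> 'a) \<Rightarrow> ('a \<Rightarrow> 'a)" where
  "cadjoint T = (THE S. \<forall>x y. cinner (T x) y = cinner x (S y))"

definition self_adjoint :: "('a::complex_inner \<Rightarrow> 'a) \<Rightarrow> bool" where
  "self_adjoint T \<longleftrightarrow> cadjoint T = T"

definition positive_op :: "('a::complex_inner \<Rightarrow> 'a) \<Rightarrow> bool" where
  "positive_op T \<longleftrightarrow> (\<forall>f. cinner (T f) f \<in> \<real>\<^sub>\<ge>\<^sub>0)"

definition bounded_below_op :: "('a::complex_inner \<Rightarrow> 'a) \<Rightarrow> bool" where
  "bounded_below_op T \<longleftrightarrow> (\<exists>\<alpha>>0. \<forall>f. \<alpha> * norm f \<le> norm (T f))"

definition pos_bb_ops :: "('a::complex_inner \<Rightarrow> 'a) set" where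
  "pos_bb_ops = {T. bounded_clinear T \<and> self_adjoint T \<and> positive_op T \<and> bounded_below_op T}"


section \<open>Continuous functional calculus and real powers\<close>

definition invertible_op :: "('a::complex_inner \<Rightarrow> 'a) \<Rightarrow> bool" where
  "invertible_op T \<longleftrightarrow> (\<exists>R. bounded_clinear R \<and> R \<circ> T = id \<and> T \<circ> R = id)"

definition spectrum_op :: "('a::complex_inner \<Rightarrow> 'a) \<Rightarrow> complex set" where
  "spectrum_op T = {z. \<not> invertible_op (\<lambda>x. z *\<^sub>C x - T x)}"

definition poly_op :: "complex poly \<Rightarrow> ('a::complex_inner \<Rightarrow> 'a) \<Rightarrow> ('a \<Rightarrow> 'a)" where
  "poly_op p T = (\<lambda>x. \<Sum>i\<le>degree p. coeff p i *\<^sub>C (T ^^ i) x)"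

text \<open>\<open>fun_calc \<phi> T\<close> is \<open>\<phi>(T)\<close>: the limit in operator norm of \<open>p\<^sub>n(T)\<close> for polynomials \<open>p\<^sub>n\<close>
  that converge to \<open>\<phi>\<close> uniformly on the spectrum of \<open>T\<close>. It is meant for self-adjoint \<open>T\<close>
  and \<open>\<phi>\<close> continuous on the spectrum. Then the spectrum is a compact subset of the real line,
  such \<open>p\<^sub>n\<close> exist, and the limit exists and does not depend on their choice.\<close>

definition fun_calc :: "(complex \<Rightarrow> complex) \<Rightarrow> ('a::complex_inner \<Rightarrow> 'a) \<Rightarrow> ('a \<Rightarrow> 'a)" where
  "fun_calc \<phi> T = (THE R. bounded_clinear R \<and>
     (\<exists>p. uniform_limit (spectrum_op T) (\<lambda>n z. poly (p n) z) \<phi> sequentially \<and>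
          (\<lambda>n. onorm (\<lambda>x. poly_op (p n) T x - R x)) \<longlonglongrightarrow> 0))"

text \<open>For \<open>T\<close> positive and invertible the spectrum lies in \<open>{0<..}\<close>, where the complex \<open>powr\<close>
  with a real exponent agrees with the real one.\<close>

definition op_powr :: "('a::complex_inner \<Rightarrow> 'a) \<Rightarrow> real \<Rightarrow> ('a \<Rightarrow> 'a)" where
  "op_powr T r = fun_calc (\<lambda>z. z powr complex_of_real r) T"


section \<open>Biframes\<close>

text \<open>Sequences are indexed from 0.\<close>

definition biframe_bounds ::
    "(nat \<Rightarrow> 'a::complex_inner) \<Rightarrow> (nat \<Rightarrow> 'a) \<Rightarrow> real \<Rightarrow> real \<Rightarrow> bool" where
  "biframe_bounds F G A B \<longleftrightarrow> A > 0 \<and> B > 0 \<and>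
     (\<forall>f. \<exists>s::real. (\<lambda>k. cinner f (F k) * cinner (G k) f) sums complex_of_real s \<and>
            A * (norm f)\<^sup>2 \<le> s \<and> s \<le> B * (norm f)\<^sup>2)"

definition biframe :: "(nat \<Rightarrow> 'a::complex_inner) \<Rightarrow> (nat \<Rightarrow> 'a) \<Rightarrow> bool" where
  "biframe F G \<longleftrightarrow> (\<exists>A B. biframe_bounds F G A B)"

definition parseval_biframe :: "(nat \<Rightarrow> 'a::complex_inner) \<Rightarrow> (nat \<Rightarrow> 'a) \<Rightarrow> bool" where
  "parseval_biframe F G \<longleftrightarrow> biframe_bounds F G 1 1"

text \<open>The biframe operator at \<open>f\<close> is the weak limit of the partial sums.\<close>

definition biframe_op ::
    "(nat \<Rightarrow> 'a::complex_inner) \<Rightarrow> (nat \<Rightarrow> 'a) \<Rightarrow> ('a \<Rightarrow> 'a)" where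
  "biframe_op F G f = (THE s. \<forall>h.
     (\<lambda>n. cinner (\<Sum>k<n. cinner f (F k) *\<^sub>C G k) h) \<longlonglongrightarrow> cinner s h)"

end

(* The biframe operator S represents the form of (F, G), so the form of (UF, VG) is represented by
   P = V S U*: the pair is a biframe iff P is positive and bounded below, and Parseval iff P = I.
   Given P, put W = P^(-r) U S^p and T = P^(-t) V S^q; conversely the factorisations give
   V S U* = Q^t T W* Q^r = Q.  The real powers rest on |p(T)| <= sup |p| over the spectrum, which
   follows from the presence of |p(T)|^2 in the spectrum of p(T)* p(T) and from factoring
   polynomials over the complex numbers. *)
theory Submission
  imports Defs "HOL-Computational_Algebra.Fundamental_Theorem_Algebra"
begin

section \<open>Inner products\<close>

text \<open>The biframe condition controls only the diagonal sums, with one vector in both slots,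
  and bounds neither F nor G separately, so S cannot be assembled from two bounded analysis
  operators. But each summand is itself a sesquilinear form: polarization over the complex numbers
  writes the off-diagonal series through four convergent diagonal ones, and the resulting form is
  bounded. Polarization also makes an operator determined by its quadratic form, which is why the
  Parseval property amounts to an operator identity. Powers are given by a definite description, so
  both existence and uniqueness of the limit must be proved; each reduces to the norm bound for
  polynomials. The exponents enter in one way: p + q = 1 and r + t = 1 let the powers on both sides
  of S, respectively of P, cancel that middle factor.\<close>

lemma scaleC_one: "1 *\<^sub>C x = (x::'a::complex_inner)"
  using scaleR_scaleC[of 1 x] by simp

lemma scaleC_zero_left: "0 *\<^sub>C x = (0::'a::complex_inner)"
  using scaleR_scaleC[of 0 x] by simp

lemma scaleC_minus_left: "(- c) *\<^sub>C x = - (c *\<^sub>C (x::'a::complex_inner))"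
  using scaleC_add_left[of "- c" c x] scaleC_zero_left[of x]
  by (simp add: eq_neg_iff_add_eq_0)

lemma scaleC_zero_right: "c *\<^sub>C (0::'a::complex_inner) = 0"
  using scaleC_add_right[of c "0::'a" 0] by simp

lemma scaleC_minus_right: "c *\<^sub>C (- x) = - (c *\<^sub>C (x::'a::complex_inner))"
  using scaleC_add_right[of c "- x" x] by (simp add: eq_neg_iff_add_eq_0 scaleC_zero_right)

lemma scaleC_diff_right: "c *\<^sub>C (x - y) = c *\<^sub>C x - c *\<^sub>C (y::'a::complex_inner)"
  using scaleC_add_right[of c x "- y"] by (simp add: scaleC_minus_right)

lemma cinner_zero_left [simp]: "cinner (0::'a::complex_inner) y = 0"
  using cinner_add_left[of 0 0 y] by simp

lemma cinner_zero_right [simp]: "cinner y (0::'a::complex_inner) = 0"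
  using cinner_commute[of y 0] by simp

lemma cinner_add_right: "cinner z (x + y) = cinner z x + cinner z (y::'a::complex_inner)"
  by (metis cinner_add_left cinner_commute complex_cnj_add)

lemma cinner_scaleC_right: "cinner x (a *\<^sub>C y) = cnj a * cinner x (y::'a::complex_inner)"
  by (metis cinner_commute cinner_scaleC_left complex_cnj_mult)

lemma cinner_minus_left: "cinner (- x) y = - cinner x (y::'a::complex_inner)"
  using cinner_add_left[of "- x" x y] by (simp add: eq_neg_iff_add_eq_0)

lemma cinner_minus_right: "cinner x (- y) = - cinner x (y::'a::complex_inner)"
  using cinner_add_right[of x "- y" y] by (simp add: eq_neg_iff_add_eq_0)

lemma cinner_diff_left: "cinner (x - y) z = cinner x z - cinner y (z::'a::complex_inner)"
  using cinner_add_left[of x "- y" z] by (simp add: cinner_minus_left)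

lemma cinner_diff_right: "cinner z (x - y) = cinner z x - cinner z (y::'a::complex_inner)"
  using cinner_add_right[of z x "- y"] by (simp add: cinner_minus_right)

lemma cinner_scaleR_left: "cinner (c *\<^sub>R x) y = of_real c * cinner x (y::'a::complex_inner)"
  by (simp add: scaleR_scaleC cinner_scaleC_left)

lemma cinner_scaleR_right: "cinner x (c *\<^sub>R y) = of_real c * cinner x (y::'a::complex_inner)"
  by (simp add: scaleR_scaleC cinner_scaleC_right)

lemmas cinner_algebra = cinner_add_left cinner_add_right cinner_diff_left cinner_diff_right
  cinner_scaleC_left cinner_scaleC_right cinner_scaleR_left cinner_scaleR_right
  cinner_minus_left cinner_minus_right

lemma cinner_sum_left: "cinner (\<Sum>i\<in>I. f i) y = (\<Sum>i\<in>I. cinner (f i :: 'a::complex_inner) y)"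
  by (induction I rule: infinite_finite_induct) (simp_all add: cinner_add_left)

lemma Re_cinner_self: "Re (cinner x x) = (norm (x::'a::complex_inner))\<^sup>2"
  by (simp add: cinner_self)

lemma Re_cinner_commute: "Re (cinner y x) = Re (cinner x (y::'a::complex_inner))"
  by (metis cinner_commute cnj.sel(1))

lemma norm_add_square:
  "(norm (x + y))\<^sup>2 = (norm x)\<^sup>2 + 2 * Re (cinner x y) + (norm (y::'a::complex_inner))\<^sup>2"
  using Re_cinner_commute[of x y] by (simp add: Re_cinner_self[symmetric] cinner_algebra)

lemma norm_diff_square:
  "(norm (x - y))\<^sup>2 = (norm x)\<^sup>2 - 2 * Re (cinner x y) + (norm (y::'a::complex_inner))\<^sup>2"
  using Re_cinner_commute[of x y] by (simp add: Re_cinner_self[symmetric] cinner_algebra)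

lemma norm_scaleC: "norm (c *\<^sub>C x) = norm c * norm (x::'a::complex_inner)"
proof -
  have "complex_of_real ((norm (c *\<^sub>C x))\<^sup>2) = complex_of_real ((norm c * norm x)\<^sup>2)"
    unfolding power_mult_distrib of_real_mult cinner_self[symmetric] complex_norm_square
    by (simp add: cinner_algebra)
  then show ?thesis
    by (simp only: of_real_eq_iff power2_eq_iff_nonneg norm_ge_zero mult_nonneg_nonneg)
qed

lemma cinner_Cauchy_Schwarz: "norm (cinner x y) \<le> norm x * norm (y::'a::complex_inner)"
proof (cases "y = 0")
  case False
  define c where "c = cinner x y / of_real ((norm y)\<^sup>2)"
  have "0 \<le> (norm (x - c *\<^sub>C y))\<^sup>2" by simp
  also have "\<dots> = (norm x)\<^sup>2 - 2 * Re (cnj c * cinner x y) + (norm c)\<^sup>2 * (norm y)\<^sup>2"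
    by (simp add: norm_diff_square norm_scaleC cinner_algebra power_mult_distrib)
  also have "cnj c * cinner x y = of_real ((norm (cinner x y))\<^sup>2 / (norm y)\<^sup>2)"
    using complex_norm_square[of "cinner x y"] by (simp add: c_def mult.commute)
  also have "(norm c)\<^sup>2 * (norm y)\<^sup>2 = (norm (cinner x y))\<^sup>2 / (norm y)\<^sup>2"
    using False by (simp add: c_def norm_divide power_divide norm_power) (simp add: field_simps power2_eq_square power4_eq_xxxx)
  finally have "(norm (cinner x y))\<^sup>2 / (norm y)\<^sup>2 \<le> (norm x)\<^sup>2" by simp
  then have "(norm (cinner x y))\<^sup>2 \<le> (norm x * norm y)\<^sup>2"
    using False by (simp add: field_simps power_mult_distrib)
  then show ?thesis by (simp add: power2_le_iff_abs_le)
qed simp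

lemma cinner_left_eqI:
  assumes "\<And>h. cinner x h = cinner y (h::'a::complex_inner)" shows "x = y"
proof -
  have "cinner (x - y) (x - y) = 0" using assms by (simp add: cinner_diff_left)
  then show ?thesis by (simp add: cinner_self)
qed

lemma cinner_right_eqI:
  assumes "\<And>h. cinner h x = cinner h (y::'a::complex_inner)" shows "x = y"
  by (rule cinner_left_eqI) (metis assms cinner_commute)

lemma bounded_linear_cinner_left: "bounded_linear (\<lambda>x. cinner x (y::'a::complex_inner))"
proof (rule bounded_linear_intro)
  show "norm (cinner x y) \<le> norm x * norm y" for x by (rule cinner_Cauchy_Schwarz)
qed (simp_all add: cinner_algebra scaleR_conv_of_real)

lemma bounded_linear_cinner_right: "bounded_linear (\<lambda>y. cinner (x::'a::complex_inner) y)"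
proof (rule bounded_linear_intro)
  show "norm (cinner x y) \<le> norm y * norm x" for y
    using cinner_Cauchy_Schwarz[of x y] by (simp add: mult.commute)
qed (simp_all add: cinner_algebra scaleR_conv_of_real)


section \<open>Bounded operators and adjoints\<close>

lemma bounded_clinear_bounded_linear: "bounded_clinear T \<Longrightarrow> bounded_linear T"
  by (simp add: bounded_clinear_def)

lemma bounded_clinearI:
  fixes T :: "'a::complex_inner \<Rightarrow> 'a"
  assumes "\<And>x y. T (x + y) = T x + T y" and "\<And>c x. T (c *\<^sub>C x) = c *\<^sub>C T x"
    and "\<And>x. norm (T x) \<le> norm x * K"
  shows "bounded_clinear T"
  unfolding bounded_clinear_def
proof
  show "bounded_linear T"
    by (rule bounded_linear_intro[where K = K]) (simp_all add: assms scaleR_scaleC)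
qed (simp add: assms)

lemma bounded_clinear_add: "bounded_clinear T \<Longrightarrow> T (x + y) = T x + T y"
  by (simp add: bounded_clinear_def linear_simps)

lemma bounded_clinear_diff: "bounded_clinear T \<Longrightarrow> T (x - y) = T x - T y"
  by (simp add: bounded_clinear_def linear_simps)

lemma bounded_clinear_zero: "bounded_clinear T \<Longrightarrow> T 0 = 0"
  by (simp add: bounded_clinear_def linear_simps)

lemma bounded_clinear_scaleC: "bounded_clinear T \<Longrightarrow> T (c *\<^sub>C x) = c *\<^sub>C T x"
  by (simp add: bounded_clinear_def)

lemma bounded_clinear_scaleR: "bounded_clinear T \<Longrightarrow> T (c *\<^sub>R x) = c *\<^sub>R T x"
  by (simp add: bounded_clinear_def scaleR_scaleC)

lemma bounded_clinear_onorm: "bounded_clinear T \<Longrightarrow> norm (T x) \<le> onorm T * norm x"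
  by (simp add: bounded_clinear_def onorm)

lemma bounded_clinear_compose:
  assumes "bounded_clinear S" and "bounded_clinear T" shows "bounded_clinear (S \<circ> T)"
  using assms bounded_linear_compose[of S T] by (simp add: bounded_clinear_def o_def)

lemma bounded_clinear_id: "bounded_clinear id"
  by (simp add: bounded_clinear_def id_def bounded_linear_ident)

lemma bounded_clinear_plus:
  assumes "bounded_clinear S" and "bounded_clinear T" shows "bounded_clinear (\<lambda>x. S x + T x)"
  using assms bounded_linear_add[of S T] by (simp add: bounded_clinear_def scaleC_add_right)

lemma bounded_clinear_scale:
  assumes "bounded_clinear T" shows "bounded_clinear (\<lambda>x. c *\<^sub>C T x)"
proof (rule bounded_clinearI)
  show "norm (c *\<^sub>C T x) \<le> norm x * (norm c * onorm T)" for x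
    using mult_left_mono[OF bounded_clinear_onorm[OF assms, of x], of "norm c"]
    by (simp add: norm_scaleC mult_ac)
qed (use assms in \<open>simp_all add: bounded_clinear_add bounded_clinear_scaleC scaleC_add_right
       scaleC_scaleC mult.commute\<close>)

lemma bounded_clinear_minus:
  assumes "bounded_clinear S" and "bounded_clinear T" shows "bounded_clinear (\<lambda>x. S x - T x)"
  using assms bounded_linear_sub[of S T] by (simp add: bounded_clinear_def scaleC_diff_right)

lemma bounded_linear_le_onorm_plus_1:
  assumes "bounded_linear T" shows "norm (T x) \<le> (onorm T + 1) * norm x"
  using onorm[OF assms, of x] norm_ge_zero[of x] by (simp add: distrib_right add_increasing2)

text \<open>The representing vector minimises \<open>\<parallel>x\<parallel>\<^sup>2 - 2 Re (f x)\<close>; minimising sequences are Cauchy by the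
  parallelogram law.\<close>

lemma Riesz_representation:
  fixes f :: "'a::chilbert_space \<Rightarrow> complex"
  assumes add: "\<And>x y. f (x + y) = f x + f y" and scale: "\<And>c x. f (c *\<^sub>C x) = c * f x"
    and bound: "\<And>x. norm (f x) \<le> K * norm x"
  shows "\<exists>z. \<forall>x. f x = cinner x z"
proof -
  have blf: "bounded_linear f"
    by (rule bounded_linear_intro[where K = K])
       (use bound in \<open>simp_all add: add scale scaleR_scaleC scaleR_conv_of_real mult.commute\<close>)
  define J where "J x = (norm x)\<^sup>2 - 2 * Re (f x)" for x
  have J_lower: "- K\<^sup>2 \<le> J x" for x
  proof -
    have "Re (f x) \<le> K * norm x" using bound[of x] complex_Re_le_cmod[of "f x"] by linarith
    moreover have "0 \<le> (norm x - K)\<^sup>2" by simp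
    ultimately show ?thesis by (simp add: J_def power2_diff mult.commute)
  qed
  define m where "m = (INF x. J x)"
  have bdd: "bdd_below (range J)" using J_lower by (auto simp: bdd_below_def)
  have m_le: "m \<le> J x" for x unfolding m_def by (rule cINF_lower[OF bdd]) simp
  have "\<exists>x. J x < m + inverse (real (Suc n))" for n
    using cINF_less_iff[OF _ bdd, of "m + inverse (real (Suc n))"] m_def by auto
  then obtain X where X: "\<And>n. J (X n) < m + inverse (real (Suc n))" by metis
  have par: "(norm (x - y))\<^sup>2 \<le> 2 * (J x - m) + 2 * (J y - m)" for x y
  proof -
    have h: "f ((1/2) *\<^sub>R (x + y)) = (f x + f y) / 2"
      by (simp only: scaleR_scaleC scale add) simp
    have n: "(norm ((1/2) *\<^sub>R (x + y)))\<^sup>2 = (norm (x + y))\<^sup>2 / 4"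
      by (simp add: power_divide)
    have "4 * J ((1/2) *\<^sub>R (x + y)) = (norm (x + y))\<^sup>2 - 4 * Re (f x) - 4 * Re (f y)"
      unfolding J_def h n by (simp add: field_simps)
    with m_le[of "(1/2) *\<^sub>R (x + y)"] show ?thesis
      by (simp add: J_def norm_add_square norm_diff_square)
  qed
  have "Cauchy X"
  proof (rule CauchyI)
    fix e :: real assume e: "0 < e"
    then obtain N where N: "inverse (real (Suc N)) < e\<^sup>2 / 4"
      using reals_Archimedean[of "e\<^sup>2 / 4"] by auto
    have le: "J (X k) - m < e\<^sup>2 / 4" if "k \<ge> N" for k
    proof -
      have "inverse (real (Suc k)) \<le> inverse (real (Suc N))" using that by simp
      with X[of k] N show ?thesis by linarith
    qed
    show "\<exists>M. \<forall>k\<ge>M. \<forall>n\<ge>M. norm (X k - X n) < e"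
    proof (intro exI allI impI)
      fix k n assume "N \<le> k" "N \<le> n"
      then have "(norm (X k - X n))\<^sup>2 < e\<^sup>2" using par[of "X k" "X n"] le[of k] le[of n] by simp
      then show "norm (X k - X n) < e" using e by (simp add: power2_less_imp_less)
    qed
  qed
  then obtain z where z: "X \<longlonglongrightarrow> z" using Cauchy_convergent_iff convergent_def by blast
  have "(\<lambda>n. J (X n)) \<longlonglongrightarrow> J z"
    unfolding J_def by (intro tendsto_intros bounded_linear.tendsto[OF blf] z)
  moreover have "(\<lambda>n. m + inverse (real (Suc n))) \<longlonglongrightarrow> m + 0"
    by (intro tendsto_intros LIMSEQ_inverse_real_of_nat)
  ultimately have "J z \<le> m + 0"
    by (rule LIMSEQ_le) (use X less_imp_le in blast)
  then have min: "J z \<le> J x" for x using m_le[of x] by simp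
  have Re0: "Re (f x) = Re (cinner x z)" for x
  proof -
    define d where "d = Re (cinner z x) - Re (f x)"
    \<comment> \<open>\<open>z\<close> minimises \<open>J\<close>, so J (z + e x) - J z is
      nonnegative for every real \<open>e\<close>. A quadratic in \<open>e\<close> without constant
      term has this property only if its linear coefficient vanishes.\<close>
    have q: "0 \<le> 2 * e * d + e\<^sup>2 * (norm x)\<^sup>2" for e
    proof -
      have "f (z + e *\<^sub>R x) = f z + e * f x" by (simp add: add scale scaleR_scaleC)
      moreover have "(norm (z + e *\<^sub>R x))\<^sup>2 = (norm z)\<^sup>2 + 2 * e * Re (cinner z x) + e\<^sup>2 * (norm x)\<^sup>2"
        by (simp add: norm_add_square cinner_scaleR_right power_mult_distrib)
      ultimately show ?thesis
        using min[of "z + e *\<^sub>R x"] by (simp add: J_def d_def algebra_simps)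
    qed
    have "d = 0"
    proof (rule ccontr)
      assume "d \<noteq> 0"
      \<comment> \<open>Up to the added 1, which covers x = 0, this is the minimiser of the
        quadratic.\<close>
      define e where "e = - d / ((norm x)\<^sup>2 + 1)"
      have pos: "(norm x)\<^sup>2 + 1 > 0" by (simp add: add_nonneg_pos)
      have "e\<^sup>2 * (norm x)\<^sup>2 \<le> e\<^sup>2 * ((norm x)\<^sup>2 + 1)" by (simp add: mult_left_mono)
      also have "\<dots> = - e * d" using pos by (simp add: e_def power2_eq_square)
      finally have "0 \<le> e * d" using q[of e] by simp
      moreover have "e * d < 0" using \<open>d \<noteq> 0\<close> pos
        by (simp add: e_def power2_eq_square[symmetric] divide_neg_pos)
      ultimately show False by simp
    qed
    then show ?thesis using Re_cinner_commute[of z x] by (simp add: d_def)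
  qed
  have "f x = cinner x z" for x
  proof (rule complex_eqI)
    \<comment> \<open>Multiplication by -i moves the imaginary part into the real part.\<close>
    show "Im (f x) = Im (cinner x z)"
      using Re0[of "- \<i> *\<^sub>C x"] by (simp add: scale cinner_scaleC_left)
  qed (rule Re0)
  then show ?thesis by blast
qed

text \<open>For fixed \<open>f\<close> the conjugate of \<open>s f h\<close> is linear in
  \<open>h\<close>, so Riesz yields the vector \<open>S f\<close>. Linearity of \<open>S\<close>
  holds because inner products separate points; its bound comes from the choice h = S x.\<close>

lemma sesquilinear_form_representation:
  fixes s :: "'a::chilbert_space \<Rightarrow> 'a \<Rightarrow> complex"
  assumes add_left: "\<And>x y h. s (x + y) h = s x h + s y h"
    and add_right: "\<And>f x y. s f (x + y) = s f x + s f y"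
    and scale_left: "\<And>c x h. s (c *\<^sub>C x) h = c * s x h"
    and scale_right: "\<And>c f x. s f (c *\<^sub>C x) = cnj c * s f x"
    and bound: "\<And>f h. norm (s f h) \<le> K * norm f * norm h"
  obtains S where "bounded_clinear S" and "\<And>f h. s f h = cinner (S f) h"
proof -
  have "\<exists>z. \<forall>h. cnj (s f h) = cinner h z" for f
    by (rule Riesz_representation[where K = "K * norm f"])
       (simp_all add: add_right scale_right bound)
  then obtain S where "\<And>f h. cnj (s f h) = cinner h (S f)" by metis
  then have S: "s f h = cinner (S f) h" for f h
    by (metis cinner_commute complex_cnj_cnj)
  have "bounded_clinear S"
  proof (rule bounded_clinearI)
    show "S (x + y) = S x + S y" for x y
      by (rule cinner_left_eqI) (simp add: cinner_add_left add_left flip: S)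
    show "S (c *\<^sub>C x) = c *\<^sub>C S x" for c x
      by (rule cinner_left_eqI) (simp add: cinner_scaleC_left scale_left flip: S)
    show "norm (S x) \<le> norm x * K" for x
    proof (cases "S x = 0")
      case True
      \<comment> \<open>The sign of \<open>K\<close> is not given; that \<open>norm x * K\<close> is
        nonnegative is read off from the bound itself.\<close>
      have "0 \<le> norm (s x x)" by simp
      also have "\<dots> \<le> K * norm x * norm x" by (rule bound)
      finally show ?thesis using True by (cases "x = 0") (simp_all add: zero_le_mult_iff)
    next
      case False
      have "norm (S x) * norm (S x) = norm (s x (S x))"
        by (simp add: S cinner_self power2_eq_square norm_mult)
      also have "\<dots> \<le> K * norm x * norm (S x)" by (rule bound)
      finally show ?thesis using False by (simp add: mult.commute)
    qed
  qed
  with S show thesis by (intro that)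
qed

text \<open>Settles the definite description once: later adjoints are identified by checking the
  adjoint identity for a candidate.\<close>

lemma cadjoint_eqI:
  assumes "\<And>x y. cinner (T x) y = cinner x (S y)" shows "cadjoint T = S"
  unfolding cadjoint_def
proof (rule the_equality)
  show "R = S" if "\<forall>x y. cinner (T x) y = cinner x (R y)" for R
  proof
    show "R y = S y" for y by (rule cinner_right_eqI) (metis that assms)
  qed
qed (simp add: assms)

text \<open>Existence of the adjoint: the form <f, T h> is sesquilinear and bounded by
  \<open>onorm T\<close>, hence represented by an operator.\<close>

lemma
  fixes T :: "'a::chilbert_space \<Rightarrow> 'a"
  assumes T: "bounded_clinear T"
  shows cadjoint_bounded_clinear: "bounded_clinear (cadjoint T)"
    and cinner_cadjoint_right: "cinner x (cadjoint T y) = cinner (T x) y"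
    and cinner_cadjoint_left: "cinner (cadjoint T x) y = cinner x (T y)"
proof -
  obtain S where S: "bounded_clinear S" "\<And>f h. cinner f (T h) = cinner (S f) h"
  proof (rule sesquilinear_form_representation[of "\<lambda>f h. cinner f (T h)" "onorm T"])
    show "norm (cinner f (T h)) \<le> onorm T * norm f * norm h" for f h
      using cinner_Cauchy_Schwarz[of f "T h"]
        mult_left_mono[OF bounded_clinear_onorm[OF T, of h] norm_ge_zero[of f]]
      by (simp add: mult_ac)
  qed (auto simp: cinner_algebra bounded_clinear_add[OF T] bounded_clinear_scaleC[OF T])
  have "cadjoint T = S"
    by (rule cadjoint_eqI) (metis S(2) cinner_commute)
  with S show "bounded_clinear (cadjoint T)" "cinner x (cadjoint T y) = cinner (T x) y"
      "cinner (cadjoint T x) y = cinner x (T y)"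
    by (simp, metis cinner_commute, simp)
qed

lemma cadjoint_compose:
  fixes S T :: "'a::chilbert_space \<Rightarrow> 'a"
  assumes "bounded_clinear S" and "bounded_clinear T"
  shows "cadjoint (S \<circ> T) = cadjoint T \<circ> cadjoint S"
  by (rule cadjoint_eqI) (simp add: cinner_cadjoint_right assms)

section \<open>Quadratic forms, self-adjointness and positivity\<close>

lemma quadratic_form_polarization:
  assumes T: "bounded_clinear T"
  shows "4 * cinner (T x) y =
    cinner (T (x + y)) (x + y) - cinner (T (x - y)) (x - y)
    + \<i> * cinner (T (x + \<i> *\<^sub>C y)) (x + \<i> *\<^sub>C y) - \<i> * cinner (T (x - \<i> *\<^sub>C y)) (x - \<i> *\<^sub>C y)"
  by (simp add: bounded_clinear_add[OF T] bounded_clinear_diff[OF T] bounded_clinear_scaleC[OF T]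
      cinner_algebra algebra_simps)

lemma quadratic_form_eqI:
  assumes "bounded_clinear S" and "bounded_clinear T"
    and "\<And>f. cinner (S f) f = cinner (T f) f"
  shows "S = T"
proof
  have "4 * cinner (S x) y = 4 * cinner (T x) y" for x y
    by (simp only: quadratic_form_polarization assms)
  then show "S x = T x" for x by (intro cinner_left_eqI) simp
qed

text \<open>The quadratic form of the adjoint is the complex conjugate of that of \<open>T\<close>,
  and a quadratic form determines its operator.\<close>

lemma self_adjoint_iff_real_form:
  fixes T :: "'a::chilbert_space \<Rightarrow> 'a"
  assumes T: "bounded_clinear T"
  shows "self_adjoint T \<longleftrightarrow> (\<forall>f. cinner (T f) f \<in> \<real>)"
proof
  assume "self_adjoint T"
  then show "\<forall>f. cinner (T f) f \<in> \<real>"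
    by (metis T Reals_cnj_iff cinner_cadjoint_right cinner_commute self_adjoint_def)
next
  assume R: "\<forall>f. cinner (T f) f \<in> \<real>"
  show "self_adjoint T"
    unfolding self_adjoint_def
  proof (rule quadratic_form_eqI[OF cadjoint_bounded_clinear[OF T] T])
    show "cinner (cadjoint T f) f = cinner (T f) f" for f
      by (metis R T Reals_cnj_iff cinner_cadjoint_left cinner_commute)
  qed
qed

text \<open>The upper bound and the passage back to \<open>bounded_below_op\<close> are
  Cauchy-Schwarz. The substance is that a lower bound for |T f| becomes one for <T f, f>, through
  the inequality |T f|^2 <= M <T f, f> for positive \<open>T\<close>.\<close>

lemma pos_bb_ops_iff:
  fixes T :: "'a::chilbert_space \<Rightarrow> 'a"
  assumes T: "bounded_clinear T"
  shows "T \<in> pos_bb_ops \<longleftrightarrow>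
    (\<exists>A>0. \<exists>B>0. \<forall>f. \<exists>s::real. cinner (T f) f = s \<and> A * (norm f)\<^sup>2 \<le> s \<and> s \<le> B * (norm f)\<^sup>2)"
    (is "_ \<longleftrightarrow> ?R")
proof
  assume P: "T \<in> pos_bb_ops"
  then obtain a where a: "a > 0" "\<And>f. a * norm f \<le> norm (T f)"
    by (auto simp: pos_bb_ops_def bounded_below_op_def)
  \<comment> \<open>Adding 1 keeps \<open>M\<close> positive even on the zero space.\<close>
  define M where "M = onorm T + 1"
  have M: "M > 0" "\<And>x. norm (T x) \<le> M * norm x"
    using onorm_pos_le[OF bounded_clinear_bounded_linear[OF T]]
      bounded_linear_le_onorm_plus_1[OF bounded_clinear_bounded_linear[OF T]] by (auto simp: M_def)
  have nn: "cinner (T f) f \<in> \<real>\<^sub>\<ge>\<^sub>0" for f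
    using P by (simp add: pos_bb_ops_def positive_op_def)
  have pos: "cinner (T f) f = of_real (Re (cinner (T f) f))" "0 \<le> Re (cinner (T f) f)" for f
    using nn[of f] by (auto simp: complex_nonneg_Reals_iff complex_eq_iff)
  have sa: "cinner (T (T f)) f = cinner (T f) (T f)" for f
    using P cinner_cadjoint_left[OF T, of "T f" f] by (simp add: pos_bb_ops_def self_adjoint_def)
  have upper: "Re (cinner (T f) f) \<le> M * (norm f)\<^sup>2" for f
  proof -
    have "Re (cinner (T f) f) \<le> norm (T f) * norm f"
      using cinner_Cauchy_Schwarz[of "T f" f] complex_Re_le_cmod[of "cinner (T f) f"] by linarith
    also have "\<dots> \<le> M * norm f * norm f" by (intro mult_right_mono M) simp
    finally show ?thesis by (simp add: power2_eq_square mult_ac)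
  qed
  have "(norm (T f))\<^sup>2 \<le> M * Re (cinner (T f) f)" for f
  proof -
    \<comment> \<open>Positivity at f - e T f leaves -2e + e^2 M as the coefficient of |T f|^2; its
      least value -1/M is taken at e = 1/M.\<close>
    let ?e = "1 / M"
    have "0 \<le> Re (cinner (T (f - ?e *\<^sub>R T f)) (f - ?e *\<^sub>R T f))" by (rule pos)
    also have "\<dots> = Re (cinner (T f) f) - 2 * ?e * (norm (T f))\<^sup>2
        + ?e\<^sup>2 * Re (cinner (T (T f)) (T f))"
      by (simp add: bounded_clinear_diff[OF T] bounded_clinear_scaleR[OF T] cinner_diff_left
          cinner_diff_right cinner_scaleR_left cinner_scaleR_right sa cinner_self power2_eq_square
          algebra_simps flip: of_real_mult of_real_divide)
    also have "\<dots> \<le> Re (cinner (T f) f) - 2 * ?e * (norm (T f))\<^sup>2 + ?e\<^sup>2 * (M * (norm (T f))\<^sup>2)"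
      by (intro add_left_mono mult_left_mono upper) simp
    also have "\<dots> = Re (cinner (T f) f) - ?e * (norm (T f))\<^sup>2"
      using M by (simp add: power2_eq_square)
    finally show ?thesis using M by (simp add: field_simps)
  qed
  moreover have "a\<^sup>2 * (norm f)\<^sup>2 \<le> (norm (T f))\<^sup>2" for f
    using power_mono[OF a(2), of f 2] a(1) by (simp add: power_mult_distrib)
  ultimately have lower: "a\<^sup>2 / M * (norm f)\<^sup>2 \<le> Re (cinner (T f) f)" for f
    using M(1) order_trans by (fastforce simp: field_simps)
  have "a\<^sup>2 / M > 0" using a M by simp
  with M(1) lower upper pos(1) show ?R by blast
next
  assume ?R
  then obtain A B where A: "A > 0"
    and AB: "\<And>f. \<exists>s::real. cinner (T f) f = s \<and> A * (norm f)\<^sup>2 \<le> s \<and> s \<le> B * (norm f)\<^sup>2"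
    by blast
  have "self_adjoint T"
    using AB self_adjoint_iff_real_form[OF T] by (metis Reals_of_real)
  moreover have "positive_op T"
    unfolding positive_op_def
  proof
    fix f
    obtain s :: real where s: "cinner (T f) f = s" "A * (norm f)\<^sup>2 \<le> s" using AB by blast
    have "0 \<le> A * (norm f)\<^sup>2" using A by simp
    with s show "cinner (T f) f \<in> \<real>\<^sub>\<ge>\<^sub>0" by simp
  qed
  moreover have "bounded_below_op T"
    unfolding bounded_below_op_def
  proof (intro exI conjI allI)
    fix f
    obtain s :: real where s: "cinner (T f) f = s" "A * (norm f)\<^sup>2 \<le> s" using AB by blast
    have "A * norm f * norm f \<le> norm (T f) * norm f"
      using cinner_Cauchy_Schwarz[of "T f" f] s by (simp add: power2_eq_square mult_ac)
    then show "A * norm f \<le> norm (T f)" by (cases "f = 0") simp_all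
  qed (rule A)
  ultimately show "T \<in> pos_bb_ops" using T by (simp add: pos_bb_ops_def)
qed


section \<open>The biframe operator\<close>

text \<open>The summand \<open>a k f h\<close> is sesquilinear for each \<open>k\<close>, so
  polarization holds term by term and the series for arbitrary \<open>f\<close>, \<open>h\<close>
  converges. Its sum is a sesquilinear form, and the upper frame bound makes it bounded.\<close>

lemma biframe_representation:
  fixes F G :: "nat \<Rightarrow> 'a::chilbert_space"
  assumes "biframe_bounds F G A B"
  obtains S where "bounded_clinear S"
    and "\<And>f h. (\<lambda>k. cinner f (F k) * cinner (G k) h) sums cinner (S f) h"
proof -
  define a where "a k f h = cinner f (F k) * cinner (G k) h" for k f h
  obtain \<sigma> :: "'a \<Rightarrow> real" where \<sigma>: "\<And>f. (\<lambda>k. a k f f) sums complex_of_real (\<sigma> f)"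
    and \<sigma>A: "\<And>f. A * (norm f)\<^sup>2 \<le> \<sigma> f" and \<sigma>B: "\<And>f. \<sigma> f \<le> B * (norm f)\<^sup>2" and pos: "A > 0" "B > 0"
    using assms unfolding biframe_bounds_def a_def by metis
  define s where "s f h = (of_real (\<sigma> (f + h)) - of_real (\<sigma> (f - h))
      + \<i> * of_real (\<sigma> (f + \<i> *\<^sub>C h)) - \<i> * of_real (\<sigma> (f - \<i> *\<^sub>C h))) / 4"
    for f h
  have polar: "a k f h = (a k (f + h) (f + h) - a k (f - h) (f - h)
      + \<i> * a k (f + \<i> *\<^sub>C h) (f + \<i> *\<^sub>C h) - \<i> * a k (f - \<i> *\<^sub>C h) (f - \<i> *\<^sub>C h)) / 4" for k f h
    unfolding a_def by (simp add: cinner_algebra) (simp add: algebra_simps)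
  have sums: "(\<lambda>k. a k f h) sums s f h" for f h
    unfolding polar[of _ f h] s_def by (intro sums_divide sums_add sums_diff sums_mult \<sigma>)
  have scale_left: "s (c *\<^sub>C x) h = c * s x h" for c x h
    by (rule sums_unique2[OF sums])
       (use sums_mult[OF sums[of x h], of c] in \<open>simp add: a_def cinner_algebra mult_ac\<close>)
  have scale_right: "s f (c *\<^sub>C x) = cnj c * s f x" for c f x
    by (rule sums_unique2[OF sums])
       (use sums_mult[OF sums[of f x], of "cnj c"] in \<open>simp add: a_def cinner_algebra mult_ac\<close>)
  have \<sigma>_norm: "norm (complex_of_real (\<sigma> f)) \<le> B * (norm f)\<^sup>2" for f
  proof -
    \<comment> \<open>The lower frame bound makes \<open>\<sigma> f\<close> nonnegative, so that the
      upper one controls its absolute value.\<close>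
    have "0 \<le> A * (norm f)\<^sup>2" using pos by simp
    with \<sigma>A[of f] \<sigma>B[of f] show ?thesis by simp
  qed
  have bound_sum: "norm (s f h) \<le> B * ((norm f)\<^sup>2 + (norm h)\<^sup>2)" for f h
  proof -
    have "4 * norm (s f h) \<le> norm (complex_of_real (\<sigma> (f + h))) + norm (complex_of_real (\<sigma> (f - h)))
        + norm (\<i> * complex_of_real (\<sigma> (f + \<i> *\<^sub>C h)))
        + norm (\<i> * complex_of_real (\<sigma> (f - \<i> *\<^sub>C h)))"
      by (simp add: s_def norm_divide del: norm_mult)
         (intro norm_triangle_le norm_triangle_le_diff add_mono order_refl, simp_all)
    also have "\<dots> \<le> B * (norm (f + h))\<^sup>2 + B * (norm (f - h))\<^sup>2 + B * (norm (f + \<i> *\<^sub>C h))\<^sup>2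
        + B * (norm (f - \<i> *\<^sub>C h))\<^sup>2"
      unfolding norm_mult norm_ii mult_1 by (intro add_mono \<sigma>_norm)
    \<comment> \<open>The cross terms cancel in pairs, as in the parallelogram law.\<close>
    also have "\<dots> = 4 * (B * ((norm f)\<^sup>2 + (norm h)\<^sup>2))"
      by (simp add: norm_add_square norm_diff_square norm_scaleC algebra_simps)
    finally show ?thesis by simp
  qed
  have bound: "norm (s f h) \<le> 2 * B * norm f * norm h" for f h
  proof (cases "f = 0 \<or> h = 0")
    case True
    then show ?thesis
      using scale_left[of 0 0 h] scale_right[of f 0 0] by (auto simp: scaleC_zero_left)
  next
    case False
    \<comment> \<open>Scaling to unit vectors turns the sum of squares into a product; for them the
      sum is 2, which is the factor in \<open>2 * B\<close>.\<close>
    define u v where "u = inverse (norm f) *\<^sub>R f" and "v = inverse (norm h) *\<^sub>R h"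
    have uv: "norm u = 1" "norm v = 1" "f = complex_of_real (norm f) *\<^sub>C u"
      "h = complex_of_real (norm h) *\<^sub>C v"
      using False by (simp_all add: u_def v_def flip: scaleR_scaleC)
    have "s f h = of_real (norm f) * (of_real (norm h) * s u v)"
      by (subst uv(3), subst uv(4), subst scale_left, subst scale_right) simp
    then have "norm (s f h) = norm f * norm h * norm (s u v)" by (simp add: norm_mult)
    also have "\<dots> \<le> norm f * norm h * (B * 2)"
      using bound_sum[of u v] by (intro mult_left_mono) (simp_all add: uv(1,2))
    finally show ?thesis by (simp add: mult_ac)
  qed
  obtain S where "bounded_clinear S" "\<And>f h. s f h = cinner (S f) h"
  proof (rule sesquilinear_form_representation[of s])
    show "s (x + y) h = s x h + s y h" for x y h
      by (rule sums_unique2[OF sums])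
         (use sums_add[OF sums[of x h] sums[of y h]] in \<open>simp add: a_def cinner_algebra algebra_simps\<close>)
    show "s f (x + y) = s f x + s f y" for f x y
      by (rule sums_unique2[OF sums])
         (use sums_add[OF sums[of f x] sums[of f y]] in \<open>simp add: a_def cinner_algebra algebra_simps\<close>)
  qed (use scale_left scale_right bound in auto)
  with sums show thesis by (intro that[of S]) (auto simp: a_def)
qed

text \<open>The partial sums converge weakly to the representing operator. Weak limits are unique,
  so the description in \<open>biframe_op\<close> denotes it.\<close>

lemma
  fixes F G :: "nat \<Rightarrow> 'a::chilbert_space"
  assumes "biframe F G"
  shows biframe_op_bounded_clinear: "bounded_clinear (biframe_op F G)"
    and biframe_op_sums: "(\<lambda>k. cinner f (F k) * cinner (G k) h) sums cinner (biframe_op F G f) h"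
proof -
  obtain A B where AB: "biframe_bounds F G A B" using assms unfolding biframe_def by blast
  obtain S where S: "bounded_clinear S"
      "\<And>f h. (\<lambda>k. cinner f (F k) * cinner (G k) h) sums cinner (S f) h"
    by (rule biframe_representation[OF AB]) (rule that)
  have lim: "(\<lambda>n. cinner (\<Sum>k<n. cinner f (F k) *\<^sub>C G k) h) \<longlonglongrightarrow> cinner (S f) h" for f h
    using S(2)[of f h] by (simp add: sums_def cinner_sum_left cinner_scaleC_left)
  have "biframe_op F G f = S f" for f
    unfolding biframe_op_def
  proof (rule the_equality)
    fix s assume s: "\<forall>h. (\<lambda>n. cinner (\<Sum>k<n. cinner f (F k) *\<^sub>C G k) h) \<longlonglongrightarrow> cinner s h"
    show "s = S f"
    proof (rule cinner_left_eqI)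
      show "cinner s h = cinner (S f) h" for h by (rule LIMSEQ_unique[OF s[rule_format] lim])
    qed
  qed (simp add: lim)
  then have "biframe_op F G = S" by blast
  with S show "bounded_clinear (biframe_op F G)"
    "(\<lambda>k. cinner f (F k) * cinner (G k) h) sums cinner (biframe_op F G f) h" by simp_all
qed

lemma biframe_bounds_iff_form:
  assumes "\<And>f. (\<lambda>k. cinner f (F k) * cinner (G k) f) sums cinner (P f) f"
  shows "biframe_bounds F G A B \<longleftrightarrow> A > 0 \<and> B > 0 \<and>
    (\<forall>f. \<exists>s::real. cinner (P f) f = s \<and> A * (norm f)\<^sup>2 \<le> s \<and> s \<le> B * (norm f)\<^sup>2)"
proof -
  have "(\<lambda>k. cinner f (F k) * cinner (G k) f) sums complex_of_real s \<longleftrightarrow> cinner (P f) f = s" for f s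
  proof
    show "cinner (P f) f = s" if "(\<lambda>k. cinner f (F k) * cinner (G k) f) sums complex_of_real s"
      using assms[of f] that by (rule sums_unique2)
    show "(\<lambda>k. cinner f (F k) * cinner (G k) f) sums complex_of_real s" if "cinner (P f) f = s"
      using assms[of f] unfolding that .
  qed
  then show ?thesis by (simp add: biframe_bounds_def)
qed

text \<open>Stated for any representing operator \<open>P\<close>, since it serves both (F, G) with
  its biframe operator and the transformed pair.\<close>

lemma biframe_iff_pos_bb_ops:
  fixes P :: "'a::chilbert_space \<Rightarrow> 'a"
  assumes "bounded_clinear P"
    and "\<And>f. (\<lambda>k. cinner f (F k) * cinner (G k) f) sums cinner (P f) f"
  shows "biframe F G \<longleftrightarrow> P \<in> pos_bb_ops"
  unfolding biframe_def pos_bb_ops_iff[OF assms(1)] biframe_bounds_iff_form[OF assms(2)]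
proof -
  have "(\<exists>A B. A > 0 \<and> B > 0 \<and> R A B) \<longleftrightarrow> (\<exists>A>0. \<exists>B>0. R A B)" for R :: "real \<Rightarrow> real \<Rightarrow> bool"
    by blast
  then show "(\<exists>A B. A > 0 \<and> B > 0 \<and> (\<forall>f. \<exists>s::real. cinner (P f) f = s \<and> A * (norm f)\<^sup>2 \<le> s \<and> s \<le> B * (norm f)\<^sup>2))
    \<longleftrightarrow> (\<exists>A>0. \<exists>B>0. \<forall>f. \<exists>s::real. cinner (P f) f = s \<and> A * (norm f)\<^sup>2 \<le> s \<and> s \<le> B * (norm f)\<^sup>2)" .
qed

text \<open>The bounds 1 and 1 squeeze the quadratic form of \<open>P\<close> to |f|^2, which is the
  form of the identity.\<close>

lemma parseval_biframe_iff_id: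
  fixes P :: "'a::chilbert_space \<Rightarrow> 'a"
  assumes P: "bounded_clinear P"
    and "\<And>f. (\<lambda>k. cinner f (F k) * cinner (G k) f) sums cinner (P f) f"
  shows "parseval_biframe F G \<longleftrightarrow> P = id"
proof -
  have "parseval_biframe F G \<longleftrightarrow> (\<forall>f. cinner (P f) f = cinner (id f) f)"
    unfolding parseval_biframe_def biframe_bounds_iff_form[OF assms(2)]
    by (auto simp: cinner_self simp flip: order_eq_iff)
  also have "\<dots> \<longleftrightarrow> P = id"
  proof
    show "P = id" if "\<forall>f. cinner (P f) f = cinner (id f) f"
    proof (rule quadratic_form_eqI[OF P bounded_clinear_id])
      show "cinner (P f) f = cinner (id f) f" for f using that by (rule spec)
    qed
  qed simp
  finally show ?thesis .
qed

text \<open>Adjoints move \<open>U\<close> and \<open>V\<close> onto the test vector, so this is the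
  series of (F, G) at two different vectors, U^* f and V^* f. Here the off-diagonal convergence is
  used.\<close>

lemma transformed_biframe_sums:
  fixes F G :: "nat \<Rightarrow> 'a::chilbert_space"
  assumes "biframe F G" and U: "bounded_clinear U" and V: "bounded_clinear V"
  shows "(\<lambda>k. cinner f (U (F k)) * cinner (V (G k)) f)
    sums cinner ((V \<circ> biframe_op F G \<circ> cadjoint U) f) f"
  using biframe_op_sums[OF assms(1), of "cadjoint U f" "cadjoint V f"]
  by (simp add: cinner_cadjoint_left[OF U] cinner_cadjoint_right[OF V])


section \<open>Invertibility and the spectrum\<close>

text \<open>The lower bound gives injectivity and, read at R y, the bound \<open>inverse c\<close>
  for the inverse.\<close>

lemma invertible_opI:
  fixes T :: "'a::complex_inner \<Rightarrow> 'a"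
  assumes T: "bounded_clinear T" and "surj T" and c: "c > 0"
    and below: "\<And>x. c * norm x \<le> norm (T x)"
  shows "invertible_op T"
proof -
  have "inj T"
  proof (rule injI)
    fix x y assume "T x = T y"
    then have "c * norm (x - y) \<le> 0" using below[of "x - y"] by (simp add: bounded_clinear_diff[OF T])
    then show "x = y" using c by (simp add: mult_le_0_iff)
  qed
  then obtain R where R: "\<And>x. R (T x) = x" "\<And>y. T (R y) = y"
    using \<open>surj T\<close> by (metis inv_f_f surj_f_inv_f)
  have "bounded_clinear R"
  proof (rule bounded_clinearI)
    show "R (x + y) = R x + R y" for x y by (metis R bounded_clinear_add[OF T])
    show "R (a *\<^sub>C x) = a *\<^sub>C R x" for a x by (metis R bounded_clinear_scaleC[OF T])
    show "norm (R x) \<le> norm x * inverse c" for x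
      using below[of "R x"] c by (simp add: R field_simps)
  qed
  with R show ?thesis by (auto simp: invertible_op_def fun_eq_iff)
qed

lemma invertible_op_bounded_below:
  assumes "invertible_op T"
  obtains K where "K > 0" and "\<And>x. norm x \<le> K * norm (T x)"
proof -
  obtain R where R: "bounded_clinear R" "R \<circ> T = id" using assms by (auto simp: invertible_op_def)
  have "norm x \<le> (onorm R + 1) * norm (T x)" for x
    using bounded_linear_le_onorm_plus_1[of R "T x"] R by (metis bounded_clinear_def comp_apply id_apply)
  moreover have "onorm R + 1 > 0"
    using onorm_pos_le[of R] R by (simp add: bounded_clinear_def)
  ultimately show thesis by (rule that[rotated])
qed

lemma invertible_op_compose:
  assumes "invertible_op S" and "invertible_op T" shows "invertible_op (\<lambda>x. S (T x))"
proof -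
  obtain R R' where "bounded_clinear R" "R \<circ> S = id" "S \<circ> R = id"
    "bounded_clinear R'" "R' \<circ> T = id" "T \<circ> R' = id"
    using assms by (auto simp: invertible_op_def)
  then show ?thesis unfolding invertible_op_def
    by (intro exI[of _ "R' \<circ> R"]) (auto simp: bounded_clinear_compose fun_eq_iff)
qed

lemma invertible_op_scale:
  fixes c :: complex
  assumes "c \<noteq> 0" shows "invertible_op (\<lambda>x::'a::complex_inner. c *\<^sub>C x)"
  unfolding invertible_op_def
  using assms bounded_clinear_scale[OF bounded_clinear_id, of "inverse c"]
  by (intro exI[of _ "\<lambda>x. inverse c *\<^sub>C x"])
     (auto simp: fun_eq_iff scaleC_scaleC scaleC_one id_def)

text \<open>A Lax-Milgram argument with the form rotated by the unimodular \<open>u\<close>.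
  Cauchy-Schwarz gives the lower bound, and T x = y is solved by a fixed point of x - w (T x - y), a
  contraction for a suitable scalar \<open>w\<close>.\<close>

lemma coercive_invertible:
  fixes T :: "'a::chilbert_space \<Rightarrow> 'a"
  assumes T: "bounded_clinear T" and u: "norm u = 1" and c: "c > 0"
    and coercive: "\<And>x. c * (norm x)\<^sup>2 \<le> Re (u * cinner (T x) x)"
  shows "invertible_op T"
proof (rule invertible_opI[OF T _ c])
  show below: "c * norm x \<le> norm (T x)" for x
  proof -
    have "c * (norm x)\<^sup>2 \<le> norm (u * cinner (T x) x)"
      using coercive[of x] complex_Re_le_cmod order_trans by blast
    also have "\<dots> \<le> norm (T x) * norm x"
      using cinner_Cauchy_Schwarz[of "T x" x] by (simp add: norm_mult u)
    finally show ?thesis by (cases "x = 0") (simp_all add: power2_eq_square mult.assoc[symmetric])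
  qed
  \<comment> \<open>Adding \<open>c\<close> makes \<open>M\<close> positive and at least
    \<open>c\<close>, so the square root in \<open>k\<close> has a nonnegative argument.\<close>
  define M where "M = onorm T + c"
  have M: "M > 0" "M \<ge> c" using c onorm_pos_le[of T] T by (auto simp: M_def bounded_clinear_def)
  have TM: "norm (T x) \<le> M * norm x" for x
    using bounded_clinear_onorm[OF T, of x] c norm_ge_zero[of x]
    by (simp add: M_def distrib_right add_increasing2)
  \<comment> \<open>This value minimises 1 - 2 \<rho> c + \<rho>^2 M^2, the factor that appears when
    |x - w T x|^2 is expanded; the minimum is k^2.\<close>
  define \<rho> where "\<rho> = c / M\<^sup>2"
  define k where "k = sqrt (1 - (c / M)\<^sup>2)"
  have cM: "0 < (c / M)\<^sup>2" "(c / M)\<^sup>2 \<le> 1" using c M by (simp_all add: power_le_one)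
  have k: "0 \<le> k" "k < 1" "k\<^sup>2 = 1 - (c / M)\<^sup>2" using cM by (simp_all add: k_def)
  define w where "w = complex_of_real \<rho> * u"
  have contr: "norm (x - w *\<^sub>C T x) \<le> k * norm x" for x
  proof -
    have "(norm (x - w *\<^sub>C T x))\<^sup>2 = (norm x)\<^sup>2 - 2 * \<rho> * Re (u * cinner (T x) x) + \<rho>\<^sup>2 * (norm (T x))\<^sup>2"
      using Re_cinner_commute[of x "w *\<^sub>C T x"]
      by (simp add: norm_diff_square norm_scaleC cinner_scaleC_left w_def norm_mult u
          power_mult_distrib mult.assoc)
    also have "\<dots> \<le> (norm x)\<^sup>2 - 2 * \<rho> * (c * (norm x)\<^sup>2) + \<rho>\<^sup>2 * (M * norm x)\<^sup>2"
      using c M by (intro add_mono diff_mono mult_left_mono coercive power_mono TM order_refl)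
        (simp_all add: \<rho>_def)
    also have "\<dots> = (k * norm x)\<^sup>2"
      using M by (simp add: k power_mult_distrib \<rho>_def) (simp add: field_simps power2_eq_square)
    finally show ?thesis by (rule power2_le_imp_le) (use k in simp)
  qed
  show "surj T"
    unfolding surj_def
  proof
    fix y
    define \<Phi> where "\<Phi> x = x - w *\<^sub>C (T x - y)" for x
    have "\<exists>!x. \<Phi> x = x"
    proof (rule banach_fix_type[OF k(1,2)], intro allI)
      fix x x'
      have "\<Phi> x - \<Phi> x' = (x - x') - w *\<^sub>C T (x - x')"
        by (simp add: \<Phi>_def bounded_clinear_diff[OF T] scaleC_diff_right)
      then show "dist (\<Phi> x) (\<Phi> x') \<le> k * dist x x'" by (simp add: dist_norm contr)
    qed
    then obtain x where "w *\<^sub>C (T x - y) = 0" by (auto simp: \<Phi>_def)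
    moreover have "norm w = \<rho>" using c M by (simp add: w_def norm_mult u \<rho>_def norm_divide norm_power)
    then have "norm w \<noteq> 0" using c M by (simp add: \<rho>_def)
    ultimately have "norm (T x - y) = 0" by (metis norm_scaleC norm_zero mult_eq_0_iff)
    then have "T x = y" by simp
    then show "\<exists>x. y = T x" by blast
  qed
qed


section \<open>Polynomials of an operator\<close>

lemma poly_op_0 [simp]: "poly_op 0 T x = 0"
  by (simp add: poly_op_def scaleC_zero_left)

text \<open>Horner recursion, which reduces the algebra of \<open>poly_op\<close> to induction over
  \<open>pCons\<close>. The case p = 0 is separate because there the degree does not grow.\<close>

lemma poly_op_pCons:
  assumes T: "bounded_clinear T"
  shows "poly_op (pCons c p) T x = c *\<^sub>C x + T (poly_op p T x)"
proof (cases "p = 0")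
  case True
  then show ?thesis by (simp add: poly_op_def bounded_clinear_zero[OF T] scaleC_zero_left)
next
  case False
  have "T (\<Sum>i\<in>I. f i) = (\<Sum>i\<in>I. T (f i))" for f and I :: "nat set"
    using T by (induction I rule: infinite_finite_induct)
      (simp_all add: bounded_clinear_zero bounded_clinear_add)
  with False show ?thesis
    by (simp add: poly_op_def sum.atMost_Suc_shift bounded_clinear_scaleC[OF T] del: sum.atMost_Suc)
qed

lemma poly_op_add:
  assumes T: "bounded_clinear T"
  shows "poly_op (p + q) T x = poly_op p T x + poly_op q T x"
  by (induction p q rule: poly_induct2)
     (simp_all add: poly_op_pCons[OF T] bounded_clinear_add[OF T] scaleC_add_left)

lemma poly_op_smult:
  assumes T: "bounded_clinear T"
  shows "poly_op (smult c p) T x = c *\<^sub>C poly_op p T x"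
  by (induction p)
     (simp_all add: poly_op_pCons[OF T] bounded_clinear_scaleC[OF T] scaleC_add_right scaleC_scaleC
       scaleC_zero_right)

lemma poly_op_diff:
  assumes T: "bounded_clinear T"
  shows "poly_op (p - q) T x = poly_op p T x - poly_op q T x"
  using poly_op_add[OF T, of "p - q" q x] by simp

lemma poly_op_mult:
  assumes T: "bounded_clinear T"
  shows "poly_op (p * q) T x = poly_op p T (poly_op q T x)"
  by (induction p)
     (simp_all add: poly_op_pCons[OF T] poly_op_add[OF T] poly_op_smult[OF T] scaleC_zero_left)

lemma bounded_clinear_poly_op:
  assumes T: "bounded_clinear T"
  shows "bounded_clinear (poly_op p T)"
proof (induction p)
  case 0
  show ?case
    using bounded_clinear_minus[OF bounded_clinear_id bounded_clinear_id, where ?'a='a]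
    by (simp add: poly_op_def scaleC_zero_left)
next
  case (pCons c p)
  have "poly_op (pCons c p) T = (\<lambda>x. c *\<^sub>C id x + (T \<circ> poly_op p T) x)"
    by (simp add: poly_op_pCons[OF T] fun_eq_iff)
  then show ?case
    using bounded_clinear_plus[OF bounded_clinear_scale[OF bounded_clinear_id]
        bounded_clinear_compose[OF T pCons.IH]] by metis
qed

text \<open>At real points \<open>map_poly cnj p\<close> takes the conjugate values of
  \<open>p\<close>, so on a real spectrum the polynomial belonging to p(T)^* p(T) is |p|^2.\<close>

lemma cinner_poly_op:
  assumes T: "bounded_clinear T" and sym: "\<And>x y. cinner (T x) y = cinner x (T y)"
  shows "cinner (poly_op p T x) y = cinner x (poly_op (map_poly cnj p) T y)"
proof (induction p arbitrary: x y)
  case (pCons c p)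
  have "T (poly_op q T z) = poly_op q T (T z)" for q z
    using poly_op_mult[OF T, of q "[:0, 1:]" z] poly_op_mult[OF T, of "[:0, 1:]" q z]
    by (simp add: poly_op_pCons[OF T] scaleC_zero_left scaleC_one bounded_clinear_zero[OF T] mult.commute)
  with pCons.IH show ?case
    by (simp add: map_poly_pCons poly_op_pCons[OF T] cinner_algebra sym)
qed simp

text \<open>One half of the spectral mapping theorem, by splitting off roots: a root z of
  \<open>r\<close> lies outside the spectrum, so T - z is invertible and the degree drops.\<close>

lemma invertible_poly_op:
  assumes T: "bounded_clinear T"
    and "r \<noteq> 0" and "\<And>z. z \<in> spectrum_op T \<Longrightarrow> poly r z \<noteq> 0"
  shows "invertible_op (poly_op r T)"
  using assms(2,3)
proof (induction "degree r" arbitrary: r)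
  case 0
  then obtain c where c: "r = [:c:]" "c \<noteq> 0" by (metis degree_eq_zeroE pCons_0_0)
  then have "poly_op r T = (\<lambda>x. c *\<^sub>C x)" by (simp add: poly_op_def)
  with c invertible_op_scale[of c] show ?case by metis
next
  case (Suc n)
  then have "\<not> constant (poly r)" by (simp add: constant_degree)
  then obtain z where z: "poly r z = 0" using fundamental_theorem_of_algebra by blast
  then obtain q where q: "r = [:- z, 1:] * q" by (metis poly_eq_0_iff_dvd dvdE)
  with Suc.prems have "q \<noteq> 0" by auto
  have "degree r = Suc (degree q)" unfolding q using \<open>q \<noteq> 0\<close> by (subst degree_mult_eq) auto
  then have "invertible_op (poly_op q T)"
    using Suc q \<open>q \<noteq> 0\<close> by (intro Suc.hyps(1)) auto
  moreover have "invertible_op (\<lambda>x. z *\<^sub>C x - T x)"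
    using Suc.prems(2)[of z] z by (auto simp: spectrum_op_def)
  \<comment> \<open>The spectrum is defined with z - T, while the linear factor evaluates to T - z;
    the scalar -1 mediates.\<close>
  then have "invertible_op (\<lambda>x. (-1) *\<^sub>C (z *\<^sub>C x - T x))"
    using invertible_op_scale[of "-1"] by (rule invertible_op_compose[rotated]) simp
  ultimately have "invertible_op (\<lambda>x. (-1) *\<^sub>C (z *\<^sub>C poly_op q T x - T (poly_op q T x)))"
    by (rule invertible_op_compose[rotated])
  moreover have "poly_op r T = (\<lambda>x. (-1) *\<^sub>C (z *\<^sub>C poly_op q T x - T (poly_op q T x)))"
    unfolding q fun_eq_iff poly_op_mult[OF T]
    by (simp add: poly_op_pCons[OF T] scaleC_minus_left scaleC_one bounded_clinear_zero[OF T])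
  ultimately show ?case by simp
qed

text \<open>If \<open>m\<close> is the operator norm of \<open>P\<close>, then unit vectors almost attaining it are approximate
  eigenvectors of \<open>P\<^sup>* P\<close> for the value \<open>m\<^sup>2\<close>.\<close>

lemma onorm_square_in_spectrum:
  fixes P P' :: "'a::complex_inner \<Rightarrow> 'a"
  assumes P: "bounded_clinear P" and adj: "\<And>x y. cinner (P x) y = cinner x (P' y)"
    and pos: "onorm P > 0"
  shows "\<not> invertible_op (\<lambda>x. P' (P x) - complex_of_real ((onorm P)\<^sup>2) *\<^sub>C x)"
proof
  define m where "m = onorm P"
  have m: "m > 0" and mP: "\<And>x. norm (P x) \<le> m * norm x"
    using pos bounded_clinear_onorm[OF P] by (auto simp: m_def)
  assume "invertible_op (\<lambda>x. P' (P x) - complex_of_real ((onorm P)\<^sup>2) *\<^sub>C x)"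
  then obtain K where K: "K > 0" "\<And>x. norm x \<le> K * norm (P' (P x) - complex_of_real (m\<^sup>2) *\<^sub>C x)"
    using invertible_op_bounded_below unfolding m_def by blast
  \<comment> \<open>The bound for \<open>P'\<close> is inherited from \<open>P\<close> through |P'
    y|^2 = <P (P' y), y>.\<close>
  have mP': "norm (P' y) \<le> m * norm y" for y
  proof -
    have "norm (P' y) * norm (P' y) = norm (cinner (P (P' y)) y)"
      by (simp add: adj cinner_self norm_mult power2_eq_square)
    also have "\<dots> \<le> m * norm (P' y) * norm y"
      using cinner_Cauchy_Schwarz[of "P (P' y)" y] mult_right_mono[OF mP[of "P' y"] norm_ge_zero[of y]]
      by linarith
    finally show ?thesis using m by (cases "P' y = 0") simp_all
  qed
  \<comment> \<open>The lower bound \<open>K\<close> for P' P - m^2 will give |x|^2 <= (K m)^2 (m^2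
    |x|^2 - |P x|^2), that is |P x|^2 <= (m^2 - d) |x|^2. This contradicts that \<open>m\<close> is
    the operator norm.\<close>
  define d where "d = 1 / (K * m)\<^sup>2"
  have d: "d > 0" using K m by (simp add: d_def)
  have le: "(norm (P x))\<^sup>2 \<le> (m\<^sup>2 - d) * (norm x)\<^sup>2" for x
  proof -
    have "(norm (P' (P x) - complex_of_real (m\<^sup>2) *\<^sub>C x))\<^sup>2
        = (norm (P' (P x)))\<^sup>2 - 2 * m\<^sup>2 * (norm (P x))\<^sup>2 + m^4 * (norm x)\<^sup>2"
    proof -
      have "(norm (y - complex_of_real c *\<^sub>C x))\<^sup>2 = (norm y)\<^sup>2 - 2 * c * Re (cinner y x) + c\<^sup>2 * (norm x)\<^sup>2"
        for c y
        by (simp add: norm_diff_square cinner_scaleC_right norm_scaleC power_mult_distrib)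
      moreover have "Re (cinner (P' (P x)) x) = (norm (P x))\<^sup>2"
        using Re_cinner_commute[of "P' (P x)" x] by (simp add: Re_cinner_self flip: adj)
      moreover have "(m\<^sup>2)\<^sup>2 = m^4" by (simp flip: power_mult)
      ultimately show ?thesis by (simp del: of_real_power)
    qed

    also have "\<dots> \<le> (m * norm (P x))\<^sup>2 - 2 * m\<^sup>2 * (norm (P x))\<^sup>2 + m^4 * (norm x)\<^sup>2"
      by (intro add_mono diff_mono power_mono mP') simp_all
    also have "\<dots> = m\<^sup>2 * (m\<^sup>2 * (norm x)\<^sup>2 - (norm (P x))\<^sup>2)"
      by (simp add: algebra_simps power_mult_distrib power2_eq_square power4_eq_xxxx)
    finally have *: "(norm (P' (P x) - complex_of_real (m\<^sup>2) *\<^sub>C x))\<^sup>2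
        \<le> m\<^sup>2 * (m\<^sup>2 * (norm x)\<^sup>2 - (norm (P x))\<^sup>2)" .
    have "(norm x)\<^sup>2 \<le> K\<^sup>2 * (norm (P' (P x) - complex_of_real (m\<^sup>2) *\<^sub>C x))\<^sup>2"
      using power_mono[OF K(2)[of x], of 2] by (simp add: power_mult_distrib)
    also have "\<dots> \<le> K\<^sup>2 * (m\<^sup>2 * (m\<^sup>2 * (norm x)\<^sup>2 - (norm (P x))\<^sup>2))"
      by (rule mult_left_mono[OF *]) simp
    finally have "(norm x)\<^sup>2 \<le> (K * m)\<^sup>2 * (m\<^sup>2 * (norm x)\<^sup>2 - (norm (P x))\<^sup>2)"
      by (simp only: power_mult_distrib mult.assoc)
    then have "d * (norm x)\<^sup>2 \<le> m\<^sup>2 * (norm x)\<^sup>2 - (norm (P x))\<^sup>2"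
      using K m by (simp add: d_def pos_divide_le_eq mult.commute)
    then show ?thesis by (simp add: left_diff_distrib)
  qed
  \<comment> \<open>The sign of m^2 - d is unknown, so the root is taken of its positive
    part.\<close>
  have "norm (P x) \<le> sqrt (max 0 (m\<^sup>2 - d)) * norm x" for x
  proof (rule power2_le_imp_le)
    have "(m\<^sup>2 - d) * (norm x)\<^sup>2 \<le> max 0 (m\<^sup>2 - d) * (norm x)\<^sup>2" by (intro mult_right_mono) simp_all
    with le[of x] show "(norm (P x))\<^sup>2 \<le> (sqrt (max 0 (m\<^sup>2 - d)) * norm x)\<^sup>2"
      by (simp add: power_mult_distrib)
  qed simp
  then have "m \<le> sqrt (max 0 (m\<^sup>2 - d))"
    unfolding m_def by (intro onorm_bound) (simp_all add: m_def)
  then have "m\<^sup>2 \<le> max 0 (m\<^sup>2 - d)" using m power_mono[of m "sqrt (max 0 (m\<^sup>2 - d))" 2] by simp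
  then show False using d m by (simp add: max_def split: if_splits)
qed


section \<open>Functional calculus of positive invertible operators\<close>

text \<open>Explicit form bounds instead of membership in \<open>pos_bb_ops\<close>: they name the
  interval that contains the spectrum and on which the powers are approximated.\<close>

locale positive_invertible_op =
  fixes T :: "'a::chilbert_space \<Rightarrow> 'a" and A B :: real
  assumes T: "bounded_clinear T" and A: "A > 0"
    and form: "\<exists>s::real. cinner (T f) f = s \<and> A * (norm f)\<^sup>2 \<le> s \<and> s \<le> B * (norm f)\<^sup>2"
begin

lemma symmetric: "cinner (T x) y = cinner x (T y)"
proof -
  have "self_adjoint T" using form self_adjoint_iff_real_form[OF T] by (metis Reals_of_real)
  then show ?thesis using cinner_cadjoint_right[OF T] by (simp add: self_adjoint_def)
qed

text \<open>The values of the form at unit vectors lie in [A, B]. If a line separates z from this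
  interval, a rotation makes the form of z - T coercive, so z is not in the spectrum.\<close>

lemma spectrum_subset: "spectrum_op T \<subseteq> of_real ` {A..B}"
proof
  fix z assume z: "z \<in> spectrum_op T"
  let ?L = "\<lambda>x. z *\<^sub>C x - T x"
  have L: "bounded_clinear ?L"
    using bounded_clinear_minus[OF bounded_clinear_scale[OF bounded_clinear_id] T] by simp
  have not_coercive: False
    if u: "norm u = 1" and c: "c > 0" and le: "\<And>s. A \<le> s \<Longrightarrow> s \<le> B \<Longrightarrow> c \<le> Re (u * (z - of_real s))"
    for u c
  proof -
    have "c * (norm x)\<^sup>2 \<le> Re (u * cinner (?L x) x)" for x
    proof (cases "x = 0")
      case False
      have Re_mult_of_real: "Re (w * complex_of_real a) = Re w * a" for w a by simp
      from False have pos: "(norm x)\<^sup>2 > 0" by simp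
      obtain s :: real where s: "cinner (T x) x = s" "A * (norm x)\<^sup>2 \<le> s" "s \<le> B * (norm x)\<^sup>2"
        using form by blast
      define s' where "s' = s / (norm x)\<^sup>2"
      have "s = s' * (norm x)\<^sup>2" using pos by (simp add: s'_def)
      moreover have "A \<le> s'" "s' \<le> B" using s pos by (simp_all add: s'_def field_simps)
      ultimately have "c * (norm x)\<^sup>2 \<le> Re (u * (z - of_real s')) * (norm x)\<^sup>2"
        using le by (intro mult_right_mono) auto
      also have "\<dots> = Re (u * (z - of_real s') * of_real ((norm x)\<^sup>2))"
        by (simp only: Re_mult_of_real)
      also have "u * (z - of_real s') * of_real ((norm x)\<^sup>2) = u * cinner (?L x) x"
        by (simp add: cinner_diff_left cinner_scaleC_left cinner_self s(1) \<open>s = s' * (norm x)\<^sup>2\<close>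
            algebra_simps)
      finally show ?thesis .
    qed simp
    then have "invertible_op ?L" using coercive_invertible[OF L u c] by blast
    then show False using z by (simp add: spectrum_op_def)
  qed
  \<comment> \<open>Four rotations exclude the open half-planes above and below the real axis, left
    of A and right of B.\<close>
  have "\<not> Im z > 0" using not_coercive[of "- \<i>" "Im z"] by auto
  moreover have "\<not> Im z < 0" using not_coercive[of \<i> "- Im z"] by auto
  moreover have "\<not> Re z < A" using not_coercive[of "- 1" "A - Re z"] by auto
  moreover have "\<not> Re z > B" using not_coercive[of 1 "Re z - B"] by auto
  ultimately have "z = of_real (Re z)" "Re z \<in> {A..B}" by (simp_all add: complex_eq_iff)
  then show "z \<in> of_real ` {A..B}" by blast
qed

lemma spectrum_real: "z \<in> spectrum_op T \<Longrightarrow> cnj z = z"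
  using spectrum_subset by auto

text \<open>With an empty spectrum every nonzero polynomial of \<open>T\<close> would be invertible,
  but T^2 - m^2 with m = \<open>onorm T\<close> is not. On the zero space all operators are
  invertible, hence the vector \<open>x\<close>.\<close>

lemma spectrum_nonempty:
  assumes "(x::'a) \<noteq> 0" shows "spectrum_op T \<noteq> {}"
proof
  assume empty: "spectrum_op T = {}"
  have "onorm T > 0"
  proof -
    have "T x \<noteq> 0"
    proof
      assume "T x = 0"
      then have "A * (norm x)\<^sup>2 \<le> 0" using form[of x] by auto
      with A assms show False by (simp add: mult_le_0_iff)
    qed
    then show ?thesis
      using onorm_pos_lt[OF bounded_clinear_bounded_linear[OF T]] by blast
  qed
  then have "\<not> invertible_op (\<lambda>x. T (T x) - complex_of_real ((onorm T)\<^sup>2) *\<^sub>C x)"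
    by (rule onorm_square_in_spectrum[OF T symmetric])
  moreover have "(\<lambda>x. T (T x) - complex_of_real ((onorm T)\<^sup>2) *\<^sub>C x)
      = poly_op [:- complex_of_real ((onorm T)\<^sup>2), 0, 1:] T"
    by (simp add: fun_eq_iff poly_op_pCons[OF T] bounded_clinear_zero[OF T] scaleC_zero_left
        scaleC_one scaleC_minus_left)
  moreover have "invertible_op (poly_op [:- complex_of_real ((onorm T)\<^sup>2), 0, 1:] T)"
    by (rule invertible_poly_op[OF T]) (simp_all add: empty)
  ultimately show False by simp
qed

lemma norm_poly_op_le:
  assumes C: "C \<ge> 0" and pC: "\<And>z. z \<in> spectrum_op T \<Longrightarrow> norm (poly p z) \<le> C"
  shows "norm (poly_op p T x) \<le> C * norm x"
proof -
  let ?P = "poly_op p T" and ?P' = "poly_op (map_poly cnj p) T"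
  note P = bounded_clinear_poly_op[OF T, of p]
  have "onorm ?P \<le> C"
  proof (rule ccontr)
    assume *: "\<not> onorm ?P \<le> C"
    define m where "m = onorm ?P"
    have m: "m > C" "m > 0" using * C by (simp_all add: m_def)
    obtain x where "x \<noteq> (0::'a)"
    proof -
      have "\<exists>x. ?P x \<noteq> 0"
        using m onorm_pos_lt[OF bounded_clinear_bounded_linear[OF P]] by (simp add: m_def)
      then show thesis using that bounded_clinear_zero[OF P] by metis
    qed
    \<comment> \<open>\<open>invertible_poly_op\<close> concerns nonzero polynomials. Should
      \<open>r\<close> below vanish identically, every spectral point is a root, and this point
      serves as one.\<close>
    then obtain z\<^sub>0 where z\<^sub>0: "z\<^sub>0 \<in> spectrum_op T" using spectrum_nonempty by blast
    define r where "r = map_poly cnj p * p - [:complex_of_real (m\<^sup>2):]"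
    have "\<not> invertible_op (\<lambda>x. ?P' (?P x) - complex_of_real (m\<^sup>2) *\<^sub>C x)"
      unfolding m_def
      by (rule onorm_square_in_spectrum[OF P cinner_poly_op[OF T symmetric]]) (use m m_def in simp)
    also have "(\<lambda>x. ?P' (?P x) - complex_of_real (m\<^sup>2) *\<^sub>C x) = poly_op r T"
      by (simp add: fun_eq_iff r_def poly_op_diff[OF T] poly_op_mult[OF T] poly_op_pCons[OF T]
          bounded_clinear_zero[OF T])
    finally have "r = 0 \<or> (\<exists>z\<in>spectrum_op T. poly r z = 0)"
      using invertible_poly_op[OF T] by blast
    then obtain z where z: "z \<in> spectrum_op T" "poly r z = 0" using z\<^sub>0 by auto
    have "cnj (poly p z) * poly p z = complex_of_real (m\<^sup>2)"
      using z spectrum_real[OF z(1)] by (simp add: r_def)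
    then have "complex_of_real ((norm (poly p z))\<^sup>2) = complex_of_real (m\<^sup>2)"
      by (simp only: complex_norm_square mult.commute)
    then have "norm (poly p z) = m"
      using m by (simp only: of_real_eq_iff) (simp add: power2_eq_iff_nonneg)
    with pC[OF z(1)] m show False by simp
  qed
  then have "onorm ?P * norm x \<le> C * norm x" by (rule mult_right_mono) simp
  with bounded_clinear_onorm[OF P, of x] show ?thesis by linarith
qed

text \<open>Pointwise limits suffice here: uniform convergence on the spectrum turns them into limits in
  operator norm, see \<open>calculus_limit_onorm\<close>.\<close>

definition has_calculus :: "(complex \<Rightarrow> complex) \<Rightarrow> ('a \<Rightarrow> 'a) \<Rightarrow> bool" where
  "has_calculus \<phi> R \<longleftrightarrow> (\<exists>p. uniform_limit (spectrum_op T) (\<lambda>n z. poly (p n) z) \<phi> sequentially \<and>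
     (\<forall>x. (\<lambda>n. poly_op (p n) T x) \<longlonglongrightarrow> R x))"

lemma uniform_limit_poly_op_Cauchy:
  assumes lim: "uniform_limit (spectrum_op T) (\<lambda>n z. poly (p n) z) \<phi> sequentially" and e: "e > 0"
  shows "\<exists>N. \<forall>n\<ge>N. \<forall>k\<ge>N. \<forall>x. norm (poly_op (p n) T x - poly_op (p k) T x) \<le> e * norm x"
proof -
  obtain N where N: "\<And>n z. n \<ge> N \<Longrightarrow> z \<in> spectrum_op T \<Longrightarrow> dist (poly (p n) z) (\<phi> z) < e / 2"
    using uniform_limitD[OF lim, of "e / 2"] e by (auto simp: eventually_sequentially)
  have "norm (poly_op (p n - p k) T x) \<le> e * norm x" if "n \<ge> N" "k \<ge> N" for n k x
  proof (rule norm_poly_op_le)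
    show "norm (poly (p n - p k) z) \<le> e" if "z \<in> spectrum_op T" for z
      using dist_triangle_half_l[of "poly (p n) z" "\<phi> z" e "poly (p k) z"]
        N[OF \<open>n \<ge> N\<close> that] N[OF \<open>k \<ge> N\<close> that] by (simp add: dist_norm norm_minus_commute)
  qed (use e in simp)
  then show ?thesis unfolding poly_op_diff[OF T] by blast
qed

text \<open>The index in the Cauchy estimate is the same for all \<open>x\<close>; letting the
  second index tend to infinity at each \<open>x\<close> upgrades the pointwise limit to the
  operator norm.\<close>

lemma
  assumes lim: "uniform_limit (spectrum_op T) (\<lambda>n z. poly (p n) z) \<phi> sequentially"
    and R: "\<And>x. (\<lambda>n. poly_op (p n) T x) \<longlonglongrightarrow> R x"
  shows calculus_limit_bounded_clinear: "bounded_clinear R"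
    and calculus_limit_onorm: "(\<lambda>n. onorm (\<lambda>x. poly_op (p n) T x - R x)) \<longlonglongrightarrow> 0"
proof -
  have close: "\<exists>N. \<forall>n\<ge>N. \<forall>x. norm (poly_op (p n) T x - R x) \<le> e * norm x" if e: "e > 0" for e
  proof -
    obtain N where N: "\<And>n k x. n \<ge> N \<Longrightarrow> k \<ge> N \<Longrightarrow>
        norm (poly_op (p n) T x - poly_op (p k) T x) \<le> e * norm x"
      using uniform_limit_poly_op_Cauchy[OF lim e] by blast
    have "norm (poly_op (p n) T x - R x) \<le> e * norm x" if "n \<ge> N" for n x
    proof (rule LIMSEQ_le_const2)
      show "(\<lambda>k. norm (poly_op (p n) T x - poly_op (p k) T x)) \<longlonglongrightarrow> norm (poly_op (p n) T x - R x)"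
        by (intro tendsto_intros R)
    qed (use N that in blast)
    then show ?thesis by blast
  qed
  note P = bounded_clinear_poly_op[OF T]
  obtain N where N: "\<And>x. norm (poly_op (p N) T x - R x) \<le> norm x" using close[of 1] by auto
  show bdd: "bounded_clinear R"
  proof (rule bounded_clinearI)
    show "R (x + y) = R x + R y" for x y
      using tendsto_add[OF R[of x] R[of y]] R[of "x + y"] LIMSEQ_unique
      unfolding bounded_clinear_add[OF P] by blast
    show "R (c *\<^sub>C x) = c *\<^sub>C R x" for c x
    proof -
      have "(\<lambda>n. c *\<^sub>C poly_op (p n) T x) \<longlonglongrightarrow> c *\<^sub>C R x"
        using bounded_linear.tendsto[OF bounded_clinear_bounded_linear[OF
              bounded_clinear_scale[OF bounded_clinear_id]] R] by simp
      then show ?thesis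
        using R[of "c *\<^sub>C x"] LIMSEQ_unique unfolding bounded_clinear_scaleC[OF P] by blast
    qed
    show "norm (R x) \<le> norm x * (onorm (poly_op (p N) T) + 1)" for x
      using norm_triangle_sub[of "R x" "poly_op (p N) T x"] N[of x]
        bounded_clinear_onorm[OF P, of "p N" x]
      by (simp add: norm_minus_commute algebra_simps)
  qed
  show "(\<lambda>n. onorm (\<lambda>x. poly_op (p n) T x - R x)) \<longlonglongrightarrow> 0"
  proof (rule LIMSEQ_I)
    fix e :: real assume e: "e > 0"
    then obtain N where N: "\<And>n x. n \<ge> N \<Longrightarrow> norm (poly_op (p n) T x - R x) \<le> e / 2 * norm x"
      using close[of "e / 2"] by auto
    have "norm (onorm (\<lambda>x. poly_op (p n) T x - R x) - 0) < e" if "n \<ge> N" for n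
    proof -
      have "bounded_linear (\<lambda>x. poly_op (p n) T x - R x)"
        using bounded_clinear_minus[OF P bdd] by (rule bounded_clinear_bounded_linear)
      moreover have "onorm (\<lambda>x. poly_op (p n) T x - R x) \<le> e / 2"
        by (rule onorm_bound) (use N that e in auto)
      ultimately show ?thesis using onorm_pos_le e by fastforce
    qed
    then show "\<exists>N. \<forall>n\<ge>N. norm (onorm (\<lambda>x. poly_op (p n) T x - R x) - 0) < e" by blast
  qed
qed

lemma has_calculus_bounded_clinear: "has_calculus \<phi> R \<Longrightarrow> bounded_clinear R"
  unfolding has_calculus_def using calculus_limit_bounded_clinear by blast

text \<open>Two approximating sequences are both eventually within e/2 of \<open>\<phi>\<close> on
  the spectrum, so the norm bound applies to their difference.\<close>

lemma has_calculus_unique: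
  assumes "has_calculus \<phi> R" and "has_calculus \<phi> R'" shows "R = R'"
proof
  fix x
  obtain p p' where lim: "uniform_limit (spectrum_op T) (\<lambda>n z. poly (p n) z) \<phi> sequentially"
      "uniform_limit (spectrum_op T) (\<lambda>n z. poly (p' n) z) \<phi> sequentially"
    and R: "(\<lambda>n. poly_op (p n) T x) \<longlonglongrightarrow> R x" "(\<lambda>n. poly_op (p' n) T x) \<longlonglongrightarrow> R' x"
    using assms unfolding has_calculus_def by blast
  have le: "norm (R x - R' x) \<le> e * norm x" if e: "e > 0" for e
  proof (rule LIMSEQ_le_const2)
    show "(\<lambda>n. norm (poly_op (p n) T x - poly_op (p' n) T x)) \<longlonglongrightarrow> norm (R x - R' x)"
      by (intro tendsto_intros R)
    obtain N where N: "\<And>n z. n \<ge> N \<Longrightarrow> z \<in> spectrum_op T \<Longrightarrow> dist (poly (p n) z) (\<phi> z) < e / 2"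
      using uniform_limitD[OF lim(1), of "e / 2"] e by (auto simp: eventually_sequentially)
    obtain N' where N': "\<And>n z. n \<ge> N' \<Longrightarrow> z \<in> spectrum_op T \<Longrightarrow> dist (poly (p' n) z) (\<phi> z) < e / 2"
      using uniform_limitD[OF lim(2), of "e / 2"] e by (auto simp: eventually_sequentially)
    have "norm (poly (p n - p' n) z) \<le> e" if "n \<ge> max N N'" "z \<in> spectrum_op T" for n z
      using that dist_triangle_half_l[of "poly (p n) z" "\<phi> z" e "poly (p' n) z"] N[of n z] N'[of n z]
      by (simp add: dist_norm norm_minus_commute)
    then have "norm (poly_op (p n - p' n) T x) \<le> e * norm x" if "n \<ge> max N N'" for n
      using norm_poly_op_le[of e "p n - p' n" x] that e by simp
    then show "\<exists>N. \<forall>n\<ge>N. norm (poly_op (p n) T x - poly_op (p' n) T x) \<le> e * norm x"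
      unfolding poly_op_diff[OF T] by blast
  qed
  have "norm (R x - R' x) \<le> 0"
  proof (cases "x = 0")
    case True
    then show ?thesis using le[of 1] by simp
  next
    case False
    show ?thesis
    proof (rule field_le_epsilon)
      show "norm (R x - R' x) \<le> 0 + e" if "e > 0" for e
        using le[of "e / norm x"] that False by simp
    qed
  qed
  then show "R x = R' x" by simp
qed

text \<open>Convergence in operator norm implies pointwise convergence, so every candidate for the
  description in \<open>fun_calc\<close> satisfies \<open>has_calculus\<close>, and uniqueness
  decides.\<close>

lemma fun_calc_eqI:
  assumes "has_calculus \<phi> R" shows "fun_calc \<phi> T = R"
  unfolding fun_calc_def
proof (rule the_equality)
  obtain p where p: "uniform_limit (spectrum_op T) (\<lambda>n z. poly (p n) z) \<phi> sequentially"
      "\<And>x. (\<lambda>n. poly_op (p n) T x) \<longlonglongrightarrow> R x"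
    using assms unfolding has_calculus_def by blast
  with calculus_limit_bounded_clinear[OF p] calculus_limit_onorm[OF p]
  show "bounded_clinear R \<and>
     (\<exists>p. uniform_limit (spectrum_op T) (\<lambda>n z. poly (p n) z) \<phi> sequentially \<and>
          (\<lambda>n. onorm (\<lambda>x. poly_op (p n) T x - R x)) \<longlonglongrightarrow> 0)" by blast
next
  fix R' assume "bounded_clinear R' \<and>
     (\<exists>p. uniform_limit (spectrum_op T) (\<lambda>n z. poly (p n) z) \<phi> sequentially \<and>
          (\<lambda>n. onorm (\<lambda>x. poly_op (p n) T x - R' x)) \<longlonglongrightarrow> 0)"
  then obtain p where R': "bounded_clinear R'"
    and p: "uniform_limit (spectrum_op T) (\<lambda>n z. poly (p n) z) \<phi> sequentially"
      "(\<lambda>n. onorm (\<lambda>x. poly_op (p n) T x - R' x)) \<longlonglongrightarrow> 0" by blast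
  have "(\<lambda>n. poly_op (p n) T x) \<longlonglongrightarrow> R' x" for x
  proof (rule LIM_zero_cancel)
    have "(\<lambda>n. onorm (\<lambda>x. poly_op (p n) T x - R' x) * norm x) \<longlonglongrightarrow> 0"
      using tendsto_mult_right[OF p(2), of "norm x"] by simp
    then show "(\<lambda>n. poly_op (p n) T x - R' x) \<longlonglongrightarrow> 0"
    proof (rule Lim_null_comparison[rotated], intro always_eventually allI)
      show "norm (poly_op (p n) T x - R' x) \<le> onorm (\<lambda>x. poly_op (p n) T x - R' x) * norm x" for n
        using bounded_clinear_onorm[OF bounded_clinear_minus[OF bounded_clinear_poly_op[OF T] R'],
            of "p n" x] by simp
    qed
  qed
  with p(1) have "has_calculus \<phi> R'" unfolding has_calculus_def by blast
  then show "R' = R" using assms by (rule has_calculus_unique)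
qed

lemma has_calculus_mult:
  assumes "has_calculus \<phi> R" and "has_calculus \<psi> R'"
    and bdd: "bounded (\<phi> ` spectrum_op T)" "bounded (\<psi> ` spectrum_op T)"
  shows "has_calculus (\<lambda>z. \<phi> z * \<psi> z) (R \<circ> R')"
proof -
  obtain p q where p: "uniform_limit (spectrum_op T) (\<lambda>n z. poly (p n) z) \<phi> sequentially"
      "\<And>x. (\<lambda>n. poly_op (p n) T x) \<longlonglongrightarrow> R x"
    and q: "uniform_limit (spectrum_op T) (\<lambda>n z. poly (q n) z) \<psi> sequentially"
      "\<And>x. (\<lambda>n. poly_op (q n) T x) \<longlonglongrightarrow> R' x"
    using assms unfolding has_calculus_def by blast
  obtain C where C: "C > 0" "\<And>z. z \<in> spectrum_op T \<Longrightarrow> norm (\<phi> z) \<le> C"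
    using bdd(1) unfolding bounded_pos by auto
  \<comment> \<open>Both factors vary with \<open>n\<close>; a bound on p_n(T) that is uniform in
    \<open>n\<close> makes the product of the pointwise limits the limit of the products.\<close>
  have bound: "\<forall>\<^sub>F n in sequentially. \<forall>y. norm (poly_op (p n) T y) \<le> (C + 1) * norm y"
    using uniform_limitD[OF p(1), of 1]
  proof (simp, elim eventually_mono, intro allI norm_poly_op_le)
    fix n z assume "\<forall>z\<in>spectrum_op T. dist (poly (p n) z) (\<phi> z) < 1" "z \<in> spectrum_op T"
    then show "norm (poly (p n) z) \<le> C + 1"
      using norm_triangle_sub[of "poly (p n) z" "\<phi> z"] C(2)[of z] by (force simp: dist_norm)
  qed (use C in simp)
  have "(\<lambda>n. poly_op (p n * q n) T x) \<longlonglongrightarrow> R (R' x)" for x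
  proof -
    note P = bounded_clinear_poly_op[OF T]
    have "(\<lambda>n. poly_op (q n) T x - R' x) \<longlonglongrightarrow> 0" using q(2)[of x] by (rule LIM_zero)
    then have "(\<lambda>n. (C + 1) * norm (poly_op (q n) T x - R' x)) \<longlonglongrightarrow> 0"
      by (intro tendsto_mult_right_zero tendsto_norm_zero)
    then have "(\<lambda>n. poly_op (p n) T (poly_op (q n) T x - R' x)) \<longlonglongrightarrow> 0"
      by (rule Lim_null_comparison[rotated]) (use bound in \<open>auto elim: eventually_mono\<close>)
    from tendsto_add[OF this p(2)[of "R' x"]] show ?thesis
      by (simp add: poly_op_mult[OF T] bounded_clinear_diff[OF P])
  qed
  moreover have "uniform_limit (spectrum_op T) (\<lambda>n z. poly (p n * q n) z) (\<lambda>z. \<phi> z * \<psi> z) sequentially"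
    unfolding poly_mult by (rule uniform_lim_mult[OF p(1) q(1) bdd])
  ultimately show ?thesis
    unfolding has_calculus_def comp_def by (intro exI[of _ "\<lambda>n. p n * q n"] conjI allI)
qed

text \<open>Weierstrass approximation on [A, B], which contains the spectrum. The approximants have
  real coefficients, so each p_n(T) is symmetric, and symmetry survives the limit.\<close>

lemma has_calculus_exists:
  assumes cont: "continuous_on {A..B} g"
    and \<phi>: "\<And>x. x \<in> {A..B} \<Longrightarrow> \<phi> (complex_of_real x) = of_real (g x)"
  obtains R where "has_calculus \<phi> R" and "\<And>x y. cinner (R x) y = cinner x (R y)"
proof -
  have "\<exists>p. (\<forall>z\<in>spectrum_op T. dist (poly p z) (\<phi> z) < inverse (real (Suc n))) \<and> map_poly cnj p = p"
    for n
  proof -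
    obtain h where h: "real_polynomial_function h" "\<And>x. x \<in> {A..B} \<Longrightarrow> \<bar>g x - h x\<bar> < inverse (real (Suc n))"
      using Stone_Weierstrass_real_polynomial_function[OF compact_Icc cont, of "inverse (real (Suc n))"]
      by auto
    then obtain a k where hak: "h = (\<lambda>x. \<Sum>i\<le>k. a i * x ^ i)"
      using real_polynomial_function_iff_sum by auto
    define p where "p = (\<Sum>i\<le>k. monom (complex_of_real (a i)) i)"
    have "poly p (of_real x) = of_real (h x)" for x by (simp add: p_def hak poly_sum poly_monom)
    moreover have "map_poly cnj p = p"
      by (simp add: poly_eq_iff coeff_map_poly p_def coeff_sum if_distrib cong: if_cong)
    moreover have "dist (complex_of_real (h x)) (of_real (g x)) = \<bar>g x - h x\<bar>" for x
      by (simp add: dist_norm norm_minus_commute flip: of_real_diff)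
    ultimately show ?thesis using h(2) \<phi> spectrum_subset
      by (intro exI[of _ p]) force
  qed
  then obtain p where p: "\<And>n z. z \<in> spectrum_op T \<Longrightarrow> dist (poly (p n) z) (\<phi> z) < inverse (real (Suc n))"
    and real: "\<And>n. map_poly cnj (p n) = p n" by metis
  have lim: "uniform_limit (spectrum_op T) (\<lambda>n z. poly (p n) z) \<phi> sequentially"
  proof (rule uniform_limitI)
    fix e :: real assume "e > 0"
    then have "\<forall>\<^sub>F n in sequentially. inverse (real (Suc n)) < e"
      using LIMSEQ_inverse_real_of_nat order_tendstoD(2) by blast
    then show "\<forall>\<^sub>F n in sequentially. \<forall>z\<in>spectrum_op T. dist (poly (p n) z) (\<phi> z) < e"
      by (rule eventually_mono) (use p less_trans in blast)
  qed
  have "convergent (\<lambda>n. poly_op (p n) T x)" for x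
  proof (rule Cauchy_convergent, rule CauchyI)
    fix e :: real assume e: "e > 0"
    \<comment> \<open>The added 1 allows x = 0.\<close>
    define d where "d = e / (norm x + 1)"
    have nx: "norm x + 1 > 0" by (simp add: add_nonneg_pos)
    have d: "d > 0" "d * norm x < e" using e nx by (simp_all add: d_def field_simps)
    show "\<exists>M. \<forall>m\<ge>M. \<forall>n\<ge>M. norm (poly_op (p m) T x - poly_op (p n) T x) < e"
      using uniform_limit_poly_op_Cauchy[OF lim d(1)] d(2) by (meson le_less_trans)
  qed
  then obtain R where R: "\<And>x. (\<lambda>n. poly_op (p n) T x) \<longlonglongrightarrow> R x"
    unfolding convergent_def by metis
  have "cinner (R x) y = cinner x (R y)" for x y
  proof (rule LIMSEQ_unique)
    show "(\<lambda>n. cinner (poly_op (p n) T x) y) \<longlonglongrightarrow> cinner (R x) y"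
      by (rule bounded_linear.tendsto[OF bounded_linear_cinner_left R])
    show "(\<lambda>n. cinner (poly_op (p n) T x) y) \<longlonglongrightarrow> cinner x (R y)"
      unfolding cinner_poly_op[OF T symmetric] real
      by (rule bounded_linear.tendsto[OF bounded_linear_cinner_right R])
  qed
  with lim R show thesis by (intro that[of R]) (auto simp: has_calculus_def)
qed

section \<open>Real powers\<close>

lemma
  shows has_calculus_op_powr: "has_calculus (\<lambda>z. z powr complex_of_real a) (op_powr T a)"
    and cinner_op_powr: "cinner (op_powr T a x) y = cinner x (op_powr T a y)"
proof -
  \<comment> \<open>A > 0 keeps the interval away from 0, where negative powers are discontinuous,
    and makes the complex \<open>powr\<close> agree with the real one.\<close>
  obtain R where R: "has_calculus (\<lambda>z. z powr complex_of_real a) R"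
      "\<And>x y. cinner (R x) y = cinner x (R y)"
    by (rule has_calculus_exists[of "\<lambda>x. x powr a" "\<lambda>z. z powr complex_of_real a"])
       (use A in \<open>auto intro!: continuous_intros simp: powr_of_real\<close>)
  then show "has_calculus (\<lambda>z. z powr complex_of_real a) (op_powr T a)"
    "cinner (op_powr T a x) y = cinner x (op_powr T a y)"
    unfolding op_powr_def by (simp_all add: fun_calc_eqI[OF R(1)])
qed

lemma op_powr_bounded_clinear: "bounded_clinear (op_powr T a)"
  by (rule has_calculus_bounded_clinear[OF has_calculus_op_powr])

lemma cadjoint_op_powr: "cadjoint (op_powr T a) = op_powr T a"
  by (rule cadjoint_eqI) (rule cinner_op_powr)

lemma bounded_powr_spectrum: "bounded ((\<lambda>z. z powr complex_of_real a) ` spectrum_op T)"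
proof -
  have "compact ((\<lambda>x. x powr a) ` {A..B})"
    using A by (intro compact_continuous_image continuous_intros) auto
  then have "bounded (complex_of_real ` (\<lambda>x. x powr a) ` {A..B})"
    by (intro bounded_linear_image[OF compact_imp_bounded] bounded_linear_of_real)
  moreover have "(\<lambda>z. z powr complex_of_real a) ` spectrum_op T
      \<subseteq> complex_of_real ` (\<lambda>x. x powr a) ` {A..B}"
  proof (rule image_subsetI)
    fix z assume "z \<in> spectrum_op T"
    then obtain x where x: "x \<in> {A..B}" "z = complex_of_real x" using spectrum_subset by blast
    then have "z powr complex_of_real a = complex_of_real (x powr a)"
      using A by (simp add: powr_of_real)
    with x(1) show "z powr complex_of_real a \<in> complex_of_real ` (\<lambda>x. x powr a) ` {A..B}"
      by (intro image_eqI[OF _ imageI])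
  qed
  ultimately show ?thesis by (rule bounded_subset)
qed

lemma op_powr_add: "op_powr T a \<circ> op_powr T b = op_powr T (a + b)"
proof -
  have "has_calculus (\<lambda>z. z powr of_real a * z powr of_real b) (op_powr T a \<circ> op_powr T b)"
    by (intro has_calculus_mult has_calculus_op_powr bounded_powr_spectrum)
  then show ?thesis
    using fun_calc_eqI by (simp add: op_powr_def powr_add)
qed

lemma op_powr_0: "op_powr T 0 = id"
  unfolding op_powr_def
proof (rule fun_calc_eqI)
  \<comment> \<open>Since \<open>0 powr 0\<close> is 0, this needs 0 outside the spectrum, which A >
    0 ensures.\<close>
  have "poly 1 z = z powr complex_of_real 0" if "z \<in> spectrum_op T" for z
    using that spectrum_subset A by auto
  then have "uniform_limit (spectrum_op T) (\<lambda>n z. poly 1 z) (\<lambda>z. z powr complex_of_real 0) sequentially"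
    by (intro uniform_limitI) simp
  then show "has_calculus (\<lambda>z. z powr complex_of_real 0) id"
    unfolding has_calculus_def
    by (intro exI[of _ "\<lambda>_. 1"] conjI, assumption) (simp add: poly_op_def scaleC_one)
qed

lemma op_powr_1: "op_powr T 1 = T"
  unfolding op_powr_def
proof (rule fun_calc_eqI)
  have "uniform_limit (spectrum_op T) (\<lambda>n z. poly [:0, 1:] z) (\<lambda>z. z powr complex_of_real 1) sequentially"
    by (intro uniform_limitI) simp
  then show "has_calculus (\<lambda>z. z powr complex_of_real 1) T"
    unfolding has_calculus_def
    by (intro exI[of _ "\<lambda>_. [:0, 1:]"] conjI, assumption)
       (simp add: poly_op_pCons[OF T] scaleC_zero_left scaleC_one bounded_clinear_zero[OF T])
qed

end

text \<open>Membership in \<open>pos_bb_ops\<close> supplies the form bounds of the locale; the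
  theorem below uses powers through these laws alone.\<close>

lemma
  fixes T :: "'a::chilbert_space \<Rightarrow> 'a"
  assumes "T \<in> pos_bb_ops"
  shows pos_bb_op_powr_bounded_clinear: "bounded_clinear (op_powr T a)"
    and pos_bb_cadjoint_op_powr: "cadjoint (op_powr T a) = op_powr T a"
    and pos_bb_op_powr_add: "op_powr T a (op_powr T b x) = op_powr T (a + b) x"
    and pos_bb_op_powr_0: "op_powr T 0 = id"
    and pos_bb_op_powr_1: "op_powr T 1 = T"
proof -
  have "bounded_clinear T" using assms by (simp add: pos_bb_ops_def)
  then obtain A B where "positive_invertible_op T A B"
    using assms pos_bb_ops_iff unfolding positive_invertible_op_def by metis
  then interpret positive_invertible_op T A B .
  show "bounded_clinear (op_powr T a)" "cadjoint (op_powr T a) = op_powr T a"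
    "op_powr T a (op_powr T b x) = op_powr T (a + b) x" "op_powr T 0 = id" "op_powr T 1 = T"
    using op_powr_bounded_clinear cadjoint_op_powr op_powr_0 op_powr_1 op_powr_add[of a b]
    by (auto simp: fun_eq_iff)
qed


section \<open>Transformed biframes\<close>

theorem theorem4p10:
  fixes F G :: "nat \<Rightarrow> 'a::chilbert_space"
    and U V :: "'a \<Rightarrow> 'a"
    and p q r t :: real
  assumes "separable_space (euclidean :: 'a topology)"
    and "biframe F G"
    and "bounded_clinear U" and "bounded_clinear V"
    and "p + q = 1" and "r + t = 1"
  shows "(biframe (\<lambda>k. U (F k)) (\<lambda>k. V (G k)) \<longleftrightarrow>
           (\<exists>Q\<in>pos_bb_ops. \<exists>T W. bounded_clinear T \<and> bounded_clinear W \<and>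
              T \<circ> cadjoint W = id \<and>
              U = op_powr Q r \<circ> W \<circ> op_powr (biframe_op F G) (- p) \<and>
              V = op_powr Q t \<circ> T \<circ> op_powr (biframe_op F G) (- q))) \<and>
         (parseval_biframe (\<lambda>k. U (F k)) (\<lambda>k. V (G k)) \<longleftrightarrow>
           (\<exists>T W. bounded_clinear T \<and> bounded_clinear W \<and>
              T \<circ> cadjoint W = id \<and>
              U = W \<circ> op_powr (biframe_op F G) (- p) \<and>
              V = T \<circ> op_powr (biframe_op F G) (- q))) \<and>
         (parseval_biframe F G \<longrightarrow>
           (parseval_biframe (\<lambda>k. U (F k)) (\<lambda>k. V (G k)) \<longleftrightarrow> V \<circ> cadjoint U = id))"
proof -
  note U = \<open>bounded_clinear U\<close> and V = \<open>bounded_clinear V\<close>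
  define S where "S = biframe_op F G"
  define P where "P = V \<circ> S \<circ> cadjoint U"
  have S: "bounded_clinear S" and S_sums: "\<And>f h. (\<lambda>k. cinner f (F k) * cinner (G k) h) sums cinner (S f) h"
    unfolding S_def
    by (rule biframe_op_bounded_clinear[OF assms(2)], rule biframe_op_sums[OF assms(2)])
  have S_pos: "S \<in> pos_bb_ops"
    using biframe_iff_pos_bb_ops[OF S S_sums] assms(2) by simp
  have P: "bounded_clinear P"
    unfolding P_def by (intro bounded_clinear_compose V S cadjoint_bounded_clinear U)
  have P_sums: "(\<lambda>k. cinner f (U (F k)) * cinner (V (G k)) f) sums cinner (P f) f" for f
    unfolding P_def S_def by (rule transformed_biframe_sums[OF assms(2) U V])
  note biframe_iff = biframe_iff_pos_bb_ops[OF P P_sums]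
  note parseval_iff = parseval_biframe_iff_id[OF P P_sums]
  note Sa = pos_bb_op_powr_bounded_clinear[OF S_pos] and Sa_adj = pos_bb_cadjoint_op_powr[OF S_pos]
    and Sa_add = pos_bb_op_powr_add[OF S_pos] and S0 = pos_bb_op_powr_0[OF S_pos]
    and S1 = pos_bb_op_powr_1[OF S_pos]
  have pq: "q + p = 1" "1 - p - q = 0" using assms(5) by simp_all
  \<comment> \<open>The exponents sum to -q + 1 - p = 0. This removes \<open>S\<close> from the
    middle of V S U^* once \<open>U\<close> and \<open>V\<close> are factored.\<close>
  have sandwich: "op_powr S (- q) (S (op_powr S (- p) x)) = x" for x
    using Sa_add[of "- q" "1 + - p" x] Sa_add[of 1 "- p" x] by (simp add: S1 S0 pq(2))
  \<comment> \<open>The forward directions use the opposite reading: the positive powers contained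
    in \<open>T\<close> and \<open>W\<close> recombine to \<open>S\<close>.\<close>
  have split: "op_powr S q (op_powr S p x) = S x" for x
    by (simp add: Sa_add pq(1) S1)
  have cancel: "op_powr S a (op_powr S (- a) x) = x" for a x by (simp add: Sa_add S0)

  have "biframe (\<lambda>k. U (F k)) (\<lambda>k. V (G k)) \<longleftrightarrow>
      (\<exists>Q\<in>pos_bb_ops. \<exists>T W. bounded_clinear T \<and> bounded_clinear W \<and> T \<circ> cadjoint W = id \<and>
        U = op_powr Q r \<circ> W \<circ> op_powr S (- p) \<and> V = op_powr Q t \<circ> T \<circ> op_powr S (- q))"
    unfolding biframe_iff
  proof
    \<comment> \<open>There is no freedom in \<open>Q\<close>: any factorisation forces it to equal
      \<open>P\<close>, so \<open>P\<close> is the witness.\<close>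
    assume Q: "P \<in> pos_bb_ops"
    note Qa = pos_bb_op_powr_bounded_clinear[OF Q] and Qa_adj = pos_bb_cadjoint_op_powr[OF Q]
      and Qa_add = pos_bb_op_powr_add[OF Q] and Q0 = pos_bb_op_powr_0[OF Q]
      and Q1 = pos_bb_op_powr_1[OF Q]
    define W where "W = op_powr P (- r) \<circ> U \<circ> op_powr S p"
    define T where "T = op_powr P (- t) \<circ> V \<circ> op_powr S q"
    have W_adj: "cadjoint W = op_powr S p \<circ> cadjoint U \<circ> op_powr P (- r)"
      unfolding W_def
      by (simp add: cadjoint_compose bounded_clinear_compose U Sa Qa Sa_adj Qa_adj o_assoc)
    have "T (cadjoint W x) = x" for x
    proof -
      have "T (cadjoint W x) = op_powr P (- t) (P (op_powr P (- r) x))"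
        by (simp add: W_adj T_def split P_def)
      also have "\<dots> = op_powr P (- t + (1 + - r)) x"
        using Qa_add[of "- t" "1 + - r" x] Qa_add[of 1 "- r" x] by (simp add: Q1)
      also have "- t + (1 + - r) = 0" using assms(6) by simp
      finally show ?thesis by (simp add: Q0)
    qed
    moreover have "U = op_powr P r \<circ> W \<circ> op_powr S (- p)" "V = op_powr P t \<circ> T \<circ> op_powr S (- q)"
      by (simp_all add: fun_eq_iff W_def T_def cancel Qa_add Q0)
    moreover have "bounded_clinear T" "bounded_clinear W"
      unfolding T_def W_def by (intro bounded_clinear_compose U V Sa Qa)+
    ultimately show "\<exists>Q\<in>pos_bb_ops. \<exists>T W. bounded_clinear T \<and> bounded_clinear W \<and>
        T \<circ> cadjoint W = id \<and> U = op_powr Q r \<circ> W \<circ> op_powr S (- p) \<and>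
        V = op_powr Q t \<circ> T \<circ> op_powr S (- q)"
      by (intro bexI[OF _ Q] exI[of _ T] exI[of _ W] conjI) (simp_all add: fun_eq_iff)
  next
    assume "\<exists>Q\<in>pos_bb_ops. \<exists>T W. bounded_clinear T \<and> bounded_clinear W \<and>
        T \<circ> cadjoint W = id \<and> U = op_powr Q r \<circ> W \<circ> op_powr S (- p) \<and>
        V = op_powr Q t \<circ> T \<circ> op_powr S (- q)"
    then obtain Q T W where Q: "Q \<in> pos_bb_ops" and W: "bounded_clinear W"
      and TW: "T \<circ> cadjoint W = id" and U_eq: "U = op_powr Q r \<circ> W \<circ> op_powr S (- p)"
      and V_eq: "V = op_powr Q t \<circ> T \<circ> op_powr S (- q)" by blast
    note Qa = pos_bb_op_powr_bounded_clinear[OF Q] and Qa_adj = pos_bb_cadjoint_op_powr[OF Q]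
    have "cadjoint U = op_powr S (- p) \<circ> cadjoint W \<circ> op_powr Q r"
      unfolding U_eq
      by (simp add: cadjoint_compose bounded_clinear_compose W Sa Qa Sa_adj Qa_adj o_assoc)
    then have "P x = Q x" for x
      using TW assms(6) pos_bb_op_powr_add[OF Q, of t r x] pos_bb_op_powr_1[OF Q]
      by (simp add: P_def V_eq sandwich fun_eq_iff add.commute)
    then have "P = Q" by (rule ext)
    with Q show "P \<in> pos_bb_ops" by simp
  qed
  moreover have "parseval_biframe (\<lambda>k. U (F k)) (\<lambda>k. V (G k)) \<longleftrightarrow>
      (\<exists>T W. bounded_clinear T \<and> bounded_clinear W \<and> T \<circ> cadjoint W = id \<and>
        U = W \<circ> op_powr S (- p) \<and> V = T \<circ> op_powr S (- q))"
    unfolding parseval_iff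
  proof
    assume P_id: "P = id"
    \<comment> \<open>The witnesses of the general case with the powers of P = I left out;
      \<open>T\<close> after the adjoint of \<open>W\<close> is then \<open>P\<close>
      itself.\<close>
    define W where "W = U \<circ> op_powr S p"
    define T where "T = V \<circ> op_powr S q"
    have "cadjoint W = op_powr S p \<circ> cadjoint U"
      unfolding W_def by (simp add: cadjoint_compose U Sa Sa_adj)
    then have "T (cadjoint W x) = P x" for x by (simp add: T_def split P_def)
    moreover have "U = W \<circ> op_powr S (- p)" "V = T \<circ> op_powr S (- q)"
      by (simp_all add: fun_eq_iff W_def T_def cancel)
    moreover have "bounded_clinear T" "bounded_clinear W"
      unfolding T_def W_def by (intro bounded_clinear_compose U V Sa)+
    ultimately show "\<exists>T W. bounded_clinear T \<and> bounded_clinear W \<and> T \<circ> cadjoint W = id \<and>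
        U = W \<circ> op_powr S (- p) \<and> V = T \<circ> op_powr S (- q)"
      by (intro exI[of _ T] exI[of _ W] conjI) (simp_all add: fun_eq_iff P_id)
  next
    assume "\<exists>T W. bounded_clinear T \<and> bounded_clinear W \<and> T \<circ> cadjoint W = id \<and>
        U = W \<circ> op_powr S (- p) \<and> V = T \<circ> op_powr S (- q)"
    then obtain T W where W: "bounded_clinear W" and TW: "T \<circ> cadjoint W = id"
      and U_eq: "U = W \<circ> op_powr S (- p)" and V_eq: "V = T \<circ> op_powr S (- q)" by blast
    have "cadjoint U = op_powr S (- p) \<circ> cadjoint W"
      unfolding U_eq by (simp add: cadjoint_compose W Sa Sa_adj)
    then show "P = id" using TW by (simp add: P_def V_eq sandwich fun_eq_iff)
  qed
  \<comment> \<open>If (F, G) is Parseval, the same criterion applied to it gives S = I, so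
    \<open>P\<close> reduces to \<open>V\<close> after the adjoint of \<open>U\<close>.\<close>
  moreover have "parseval_biframe (\<lambda>k. U (F k)) (\<lambda>k. V (G k)) \<longleftrightarrow> V \<circ> cadjoint U = id"
    if "parseval_biframe F G"
    using that parseval_iff unfolding parseval_biframe_iff_id[OF S S_sums] by (simp add: P_def fun_eq_iff)
  ultimately show ?thesis unfolding S_def by blast
qed

end
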